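(* Let $G$ be a Carnot group, $d$ the rank of its horizontal distribution, and $\Omega\subset G$ a bounded domain. Let $V$ be a function on $\Omega$ such that $-\Delta_H+V$ on $\Omega$, with Dirichlet boundary conditions if $\Omega\ne G$, has purely discrete spectrum $\lambda_1\le\lambda_2\le\cdots$ bounded from below, with a complete $L^2(\Omega,v_G)$-orthonormal family of eigenfunctions $u_i$, $(-\Delta_H+V)u_i=\lambda_iu_i$. Then for every $k\ge1$ and $p\in\mathbb R$, $$\sum_{i=1}^k(\lambda_{k+1}-\lambda_i)^p\le\frac{\max\{4,2p\}}d\sum_{i=1}^k(\lambda_{k+1}-\lambda_i)^{p-1}(\lambda_i-T_i),\qquad T_i=\int_\Omega Vu_i^2\,v_G.$$ Moreover, if $V$ is bounded below on $\Omega$, then for every $k\ge1$, $$\lambda_{k+1}\le\Big(1+\frac4d\Big)\frac1k\sum_{i=1}^k\lambda_i-\frac4d\inf_\Omega V,\qquad \lambda_{k+1}\le\Big(1+\frac4d\Big)k^{2/d}\lambda_1-\Big(\big(1+\tfrac4d\big)k^{2/d}-1\Big)\inf_\Omega V.$$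
   Context: A Carnot group of step $r$ is a connected, simply connected nilpotent Lie group $G$ whose Lie algebra admits a stratification $\mathfrak g=V_1\oplus\cdots\oplus V_r$ with $[V_1,V_j]=V_{j+1}$ for $j<r$, $[V_i,V_j]\subset V_{i+j}$ ($V_k=0$ for $k>r$), equipped with a scalar product for which the $V_j$ are mutually orthogonal. Taking orthonormal bases of each $V_j$ and the corresponding left-invariant vector fields, $g_G$ is the left-invariant Riemannian metric making all these fields orthonormal, and $v_G$ its Riemannian volume. The horizontal distribution $HG$ is the left-invariant subbundle generated by $V_1$, of rank $d=\dim V_1$. If $X_1,\dots,X_d$ are the left-invariant fields associated with an orthonormal basis of $V_1$, the horizontal Laplacian is $\Delta_Hu=\sum_{i=1}^dX_i(X_iu)$. *)

theory Defs
  imports "HOL-Analysis.Analysis"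
begin

text \<open>A Carnot group is modelled in exponential coordinates: the underlying set
is the Lie algebra, identified with real^'n via an orthonormal basis adapted to
the stratification (so the scalar product is the standard dot product), with a
smooth group law for which the exponential map is the identity.\<close>

fun pd :: "'a::euclidean_space list \<Rightarrow> ('a \<Rightarrow> real) \<Rightarrow> 'a \<Rightarrow> real" where
  "pd [] f = f"
| "pd (e # es) f = (\<lambda>x. frechet_derivative (pd es f) (at x) e)"

definition smooth_on :: "'a::euclidean_space set \<Rightarrow> ('a \<Rightarrow> real) \<Rightarrow> bool" where
  "smooth_on S f \<longleftrightarrow> (\<forall>es. set es \<subseteq> Basis \<longrightarrow> (\<forall>x\<in>S. pd es f differentiable (at x)))"

definition lvf :: "(real^'n \<Rightarrow> real^'n \<Rightarrow> real^'n) \<Rightarrow> real^'n \<Rightarrow> (real^'n \<Rightarrow> real) \<Rightarrow> real^'n \<Rightarrow> real" where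
  "lvf gm v f x = deriv (\<lambda>t. f (gm x (t *\<^sub>R v))) 0"

definition lie_br :: "(real^'n \<Rightarrow> real^'n \<Rightarrow> real^'n) \<Rightarrow> real^'n \<Rightarrow> real^'n \<Rightarrow> real^'n" where
  "lie_br gm v w = (\<chi> k. lvf gm v (lvf gm w (\<lambda>y. y $ k)) 0 - lvf gm w (lvf gm v (\<lambda>y. y $ k)) 0)"

definition carnot_group :: "(real^'n \<Rightarrow> real^'n \<Rightarrow> real^'n) \<Rightarrow> (nat \<Rightarrow> (real^'n) set) \<Rightarrow> nat \<Rightarrow> bool" where
  "carnot_group gm V r \<longleftrightarrow>
     r \<ge> 1 \<and>
     (\<forall>x y z. gm (gm x y) z = gm x (gm y z)) \<and>
     (\<forall>x. gm 0 x = x \<and> gm x 0 = x) \<and>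
     (\<forall>x. \<exists>y. gm x y = 0 \<and> gm y x = 0) \<and>
     (\<forall>k. smooth_on UNIV (\<lambda>p. (gm (fst p) (snd p)) $ k)) \<and>
     (\<forall>v s t. gm (s *\<^sub>R v) (t *\<^sub>R v) = (s + t) *\<^sub>R v) \<and>
     (\<forall>j. subspace (V j)) \<and>
     (\<forall>j. j = 0 \<or> j > r \<longrightarrow> V j = {0}) \<and>
     (\<forall>i j. i \<noteq> j \<longrightarrow> (\<forall>x\<in>V i. \<forall>y\<in>V j. x \<bullet> y = 0)) \<and>
     span (\<Union>j\<in>{1..r}. V j) = UNIV \<and>
     (\<forall>j. 1 \<le> j \<and> j < r \<longrightarrow> span {lie_br gm v w | v w. v \<in> V 1 \<and> w \<in> V j} = V (Suc j)) \<and>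
     (\<forall>i j. {lie_br gm v w | v w. v \<in> V i \<and> w \<in> V j} \<subseteq> V (i + j))"

text \<open>Riemannian volume of the left-invariant metric making the left-invariant
fields of an orthonormal basis orthonormal: density 1/|det J(x)| where the
columns of J(x) are the values at x of the fields generated by the standard basis.\<close>
definition lframe :: "(real^'n \<Rightarrow> real^'n \<Rightarrow> real^'n) \<Rightarrow> real^'n \<Rightarrow> real^'n^'n" where
  "lframe gm x = (\<chi> i j. deriv (\<lambda>t. (gm x (t *\<^sub>R axis j 1)) $ i) 0)"

definition vG :: "(real^'n \<Rightarrow> real^'n \<Rightarrow> real^'n) \<Rightarrow> (real^'n) measure" where
  "vG gm = density lborel (\<lambda>x. ennreal (1 / \<bar>det (lframe gm x)\<bar>))"

definition dom_meas :: "(real^'n \<Rightarrow> real^'n \<Rightarrow> real^'n) \<Rightarrow> (real^'n) set \<Rightarrow> (real^'n) measure" where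
  "dom_meas gm Om = restrict_space (vG gm) Om"

definition tsupp :: "('a::topological_space \<Rightarrow> real) \<Rightarrow> 'a set" where
  "tsupp f = closure {x. f x \<noteq> 0}"

definition test_fun :: "(real^'n) set \<Rightarrow> (real^'n \<Rightarrow> real) \<Rightarrow> bool" where
  "test_fun Om \<phi> \<longleftrightarrow> smooth_on UNIV \<phi> \<and> compact (tsupp \<phi>) \<and> tsupp \<phi> \<subseteq> Om"

definition L2 :: "'a measure \<Rightarrow> ('a \<Rightarrow> real) \<Rightarrow> bool" where
  "L2 M f \<longleftrightarrow> f \<in> borel_measurable M \<and> integrable M (\<lambda>x. (f x)\<^sup>2)"

text \<open>Weak (distributional) derivative along a left-invariant field on Om
(left-invariant fields are divergence free for the Haar measure vG).\<close>
definition weak_lvf :: "(real^'n \<Rightarrow> real^'n \<Rightarrow> real^'n) \<Rightarrow> (real^'n) set \<Rightarrow> real^'n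
    \<Rightarrow> (real^'n \<Rightarrow> real) \<Rightarrow> (real^'n \<Rightarrow> real) \<Rightarrow> bool" where
  "weak_lvf gm Om v f g \<longleftrightarrow> L2 (dom_meas gm Om) g \<and>
     (\<forall>\<phi>. test_fun Om \<phi> \<longrightarrow>
        (\<integral>x. f x * lvf gm v \<phi> x \<partial>dom_meas gm Om) = - (\<integral>x. g x * \<phi> x \<partial>dom_meas gm Om))"

definition hsob0 :: "(real^'n \<Rightarrow> real^'n \<Rightarrow> real^'n) \<Rightarrow> (real^'n) set \<Rightarrow> (nat \<Rightarrow> real^'n) \<Rightarrow> nat
    \<Rightarrow> (real^'n \<Rightarrow> real) \<Rightarrow> (nat \<Rightarrow> real^'n \<Rightarrow> real) \<Rightarrow> bool" where
  "hsob0 gm Om b d f G \<longleftrightarrow> L2 (dom_meas gm Om) f \<and>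
     (\<forall>j<d. weak_lvf gm Om (b j) f (G j)) \<and>
     (\<exists>\<phi>s. (\<forall>m. test_fun Om (\<phi>s m)) \<and>
        (\<lambda>m. \<integral>x. (\<phi>s m x - f x)\<^sup>2 \<partial>dom_meas gm Om) \<longlonglongrightarrow> 0 \<and>
        (\<forall>j<d. (\<lambda>m. \<integral>x. (lvf gm (b j) (\<phi>s m) x - G j x)\<^sup>2 \<partial>dom_meas gm Om) \<longlonglongrightarrow> 0))"

definition form_dom :: "(real^'n \<Rightarrow> real^'n \<Rightarrow> real^'n) \<Rightarrow> (real^'n) set \<Rightarrow> (nat \<Rightarrow> real^'n) \<Rightarrow> nat
    \<Rightarrow> (real^'n \<Rightarrow> real) \<Rightarrow> (real^'n \<Rightarrow> real) \<Rightarrow> (nat \<Rightarrow> real^'n \<Rightarrow> real) \<Rightarrow> bool" where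
  "form_dom gm Om b d W f G \<longleftrightarrow> hsob0 gm Om b d f G \<and>
     integrable (dom_meas gm Om) (\<lambda>x. W x * (f x)\<^sup>2)"

definition dir_eigen :: "(real^'n \<Rightarrow> real^'n \<Rightarrow> real^'n) \<Rightarrow> (real^'n) set \<Rightarrow> (nat \<Rightarrow> real^'n) \<Rightarrow> nat
    \<Rightarrow> (real^'n \<Rightarrow> real) \<Rightarrow> real \<Rightarrow> (real^'n \<Rightarrow> real) \<Rightarrow> bool" where
  "dir_eigen gm Om b d W l u \<longleftrightarrow>
     (\<exists>G. form_dom gm Om b d W u G \<and>
       (\<forall>\<phi> H. form_dom gm Om b d W \<phi> H \<longrightarrow>
          (\<integral>x. (\<Sum>j<d. G j x * H j x) + W x * u x * \<phi> x \<partial>dom_meas gm Om)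
            = l * (\<integral>x. u x * \<phi> x \<partial>dom_meas gm Om)))"

definition discrete_dirichlet_spectrum :: "(real^'n \<Rightarrow> real^'n \<Rightarrow> real^'n) \<Rightarrow> (real^'n) set \<Rightarrow> (nat \<Rightarrow> real^'n) \<Rightarrow> nat
    \<Rightarrow> (real^'n \<Rightarrow> real) \<Rightarrow> (nat \<Rightarrow> real) \<Rightarrow> (nat \<Rightarrow> real^'n \<Rightarrow> real) \<Rightarrow> bool" where
  "discrete_dirichlet_spectrum gm Om b d W lam u \<longleftrightarrow>
     W \<in> borel_measurable (dom_meas gm Om) \<and>
     (\<forall>i\<ge>1. dir_eigen gm Om b d W (lam i) (u i)) \<and>
     (\<forall>i\<ge>1. lam i \<le> lam (Suc i)) \<and>
     filterlim lam at_top sequentially \<and>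
     (\<forall>i\<ge>1. \<forall>l\<ge>1. (\<integral>x. u i x * u l x \<partial>dom_meas gm Om) = (if i = l then 1 else 0)) \<and>
     (\<forall>f. L2 (dom_meas gm Om) f \<and> (\<forall>i\<ge>1. (\<integral>x. f x * u i x \<partial>dom_meas gm Om) = 0)
          \<longrightarrow> (AE x in dom_meas gm Om. f x = 0))"

end

theory Submission
  imports Defs
begin

text \<open>Let \<open>g\<close> be a horizontal coordinate \<open>x \<mapsto> b j \<bullet> x\<close>. Brackets are orthogonal to the first
layer, hence \<open>X i g = \<delta> i j\<close>, so the form domain is stable under multiplication by \<open>g\<close>, and the commutator of
the operator with \<open>g\<close> is \<open>-2 X j\<close>. With \<open>a i l = \<langle>g u i, u l\<rangle>\<close> this reads
\<open>(\<lambda> l - \<lambda> i) a i l = -2 \<langle>X j u i, u l\<rangle>\<close>, and Parseval and Bessel give \<open>\<Sum>l. (\<lambda> l - \<lambda> i) (a i l)\<^sup>2 = 1\<close> and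
\<open>\<Sum>l. (\<lambda> l - \<lambda> i)\<^sup>2 (a i l)\<^sup>2 \<le> 4 \<parallel>X j u i\<parallel>\<^sup>2\<close>. Weighting by \<open>(\<lambda> (k+1) - \<lambda> i)^p\<close>, antisymmetrising the part with
\<open>i, l \<le> k\<close> and summing over \<open>j\<close> gives the first inequality. The case \<open>p = 1\<close> is the bound by the mean, and
the Cheng--Yang recursion turns the case \<open>p = 2\<close> into the bound by \<open>\<lambda> 1\<close>.\<close>

subsection \<open>Scalar inequalities and the Cheng--Yang recursion\<close>

text \<open>The eigenfunctions satisfy their equation only weakly, and \<open>X j u i\<close> need
  not lie in the form domain, so the commutator is never applied to a function. It is replaced by
  testing the equation of \<open>u i\<close> with \<open>g u l\<close> and that of
  \<open>u l\<close> with \<open>g u i\<close>; in the difference only the terms where a field hits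
  \<open>g\<close> survive. This is the use of the stability of the form domain, and boundedness of
  \<open>Om\<close> makes \<open>g\<close> a bounded multiplier.

  The 1 in the first sum is \<open>-2 \<langle>g u i, X j u i\<rangle>\<close>, that is,
  \<open>X j g = 1\<close> after an integration by parts; the 4 in the second is the square of the
  commutator's factor 2. The elementary inequality behind the antisymmetrisation costs a factor
  \<open>max 1 (p / 2)\<close>, and 4 times it is \<open>max 4 (2 * p)\<close>. The
  \<open>1 / d\<close> is an average over the \<open>d\<close> coordinates, whose energies add up to
  \<open>\<lambda> i - T i\<close>.

  The group law has no explicit formula here; what is available is smoothness, associativity and
  one-parameter subgroups. That \<open>X i g = \<delta> i j\<close> holds at every point and not
  just at the identity is therefore read off from a differential equation along rays.\<close>

lemma powr_diff_le_trapezoid: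
  fixes a b p :: real
  assumes "0 < b" "b \<le> a" "2 \<le> p"
  shows "a powr p - b powr p \<le> p / 2 * (a powr (p - 1) + b powr (p - 1)) * (a - b)"
proof -
  let ?f = "\<lambda>x. p / 2 * (x powr (p - 1) + b powr (p - 1)) * (x - b) - x powr p + b powr p"
  let ?f' = "\<lambda>x. p / 2 * ((p - 1) * x powr (p - 2) * (x - b) - x powr (p - 1) + b powr (p - 1))"
  have der: "(?f has_real_derivative ?f' x) (at x)" if "0 < x" for x
  proof -
    have "x powr p = x * x powr (p - 1)" "x powr (p - 1 - 1) = x powr (p - 2)"
      using that by (simp_all add: powr_mult_base)
    moreover define h where "h = p / 2"
    moreover have "p = 2 * h" by (simp add: h_def)
    ultimately show ?thesis
      unfolding h_def[symmetric]
      using that by (auto intro!: derivative_eq_intros simp: algebra_simps)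
  qed
  \<comment> \<open>This is the tangent inequality for the convex function
    \<open>x powr (p - 1)\<close>, and convexity is where \<open>2 \<le> p\<close> enters. It is
    also why the trapezoidal rule overestimates the integral of
    \<open>p * x powr (p - 1)\<close>.\<close>
  have nonneg: "0 \<le> ?f' x" if "b \<le> x" for x
  proof -
    have "x powr (p - 1) - b powr (p - 1) \<le> (p - 1) * x powr (p - 2) * (x - b)"
    proof (cases "b = x")
      case False
      then have "b < x" using that by simp
      have "\<exists>z. b < z \<and> z < x \<and> x powr (p - 1) - b powr (p - 1) = (x - b) * ((p - 1) * z powr (p - 2))"
      proof (rule MVT2)
        fix z assume "b \<le> z" "z \<le> x"
        then show "((\<lambda>x. x powr (p - 1)) has_real_derivative (p - 1) * z powr (p - 2)) (at z)"
          using assms by (auto intro!: derivative_eq_intros)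
      qed fact
      then obtain z where z: "b < z" "z < x" 
        and eq: "x powr (p - 1) - b powr (p - 1) = (x - b) * ((p - 1) * z powr (p - 2))"
        by blast
      have "z powr (p - 2) \<le> x powr (p - 2)"
        using z assms by (intro powr_mono2) auto
      then have "(x - b) * ((p - 1) * z powr (p - 2)) \<le> (x - b) * ((p - 1) * x powr (p - 2))"
        using assms that by (intro mult_left_mono) auto
      then show ?thesis unfolding eq by (simp add: mult_ac)
    qed simp
    then show ?thesis using assms by simp
  qed
  have "?f b \<le> ?f a"
    by (rule DERIV_nonneg_imp_nondecreasing[OF assms(2)])
      (use der nonneg assms in \<open>meson order_less_le_trans\<close>)
  then show ?thesis by simp
qed

text \<open>Both sides are symmetric in \<open>a\<close> and \<open>b\<close>, so one may take
  \<open>b \<le> a\<close> and divide by \<open>a - b\<close>. For \<open>p \<le> 2\<close> and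
  constant 1 the claim then reduces to \<open>b * a powr (p - 1) \<le> a * b powr (p - 1)\<close>,
  i.e. to \<open>x powr (p - 2)\<close> being decreasing; for larger \<open>p\<close> it is the
  trapezoidal bound.\<close>

lemma powr_diff_mult_diff_le:
  fixes a b p :: real
  assumes "0 < a" "0 < b"
  shows "(a powr p - b powr p) * (a - b)
    \<le> max 1 (p / 2) * (a powr (p - 1) + b powr (p - 1)) * (a - b)\<^sup>2"
proof -
  have *: "a powr p - b powr p \<le> max 1 (p / 2) * (a powr (p - 1) + b powr (p - 1)) * (a - b)"
    if "0 < b" "b \<le> a" for a b :: real
  proof (cases "p \<le> 2")
    case True
    have sp: "x powr p = x * x powr (p - 1)" "x powr (p - 1) = x * x powr (p - 2)"
      if "0 < x" for x
      using that by (simp_all add: powr_mult_base)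
    have "a powr (p - 2) \<le> b powr (p - 2)"
      using that True by (intro powr_mono2') auto
    then have "a * b * a powr (p - 2) \<le> a * b * b powr (p - 2)"
      using that by (intro mult_left_mono) auto
    then have "b * a powr (p - 1) \<le> a * b powr (p - 1)"
      using that by (simp add: sp(2) mult_ac)
    moreover have "max 1 (p / 2) = 1" using True by simp
    ultimately show ?thesis
      using that by (simp add: sp(1) algebra_simps)
  next
    case False
    then have "max 1 (p / 2) = p / 2" by simp
    then show ?thesis using powr_diff_le_trapezoid[OF that] False by simp
  qed
  show ?thesis
  proof (cases "b \<le> a")
    case True
    then show ?thesis
      using mult_right_mono[OF *[OF assms(2) True], of "a - b"] 
      by (simp add: power2_eq_square mult_ac)
  next
    case False
    then have "a \<le> b" by simp
    from mult_right_mono[OF *[OF assms(1) this], of "b - a"] this show ?thesis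
      by (simp add: power2_eq_square algebra_simps)
  qed
qed

text \<open>Differentiating \<open>(1 - x) powr (- s)\<close> gives \<open>s\<close> times the same
  function with \<open>s + 1\<close> in place of \<open>s\<close>. Hence the Taylor bound of degree
  n for \<open>s + 1\<close> integrates to that of degree n + 1 for \<open>s\<close>; three rounds
  give the cubic.\<close>

lemma one_minus_powr_neg_lower_bound:
  fixes q t :: real
  assumes "0 \<le> q" "q < 1" "0 \<le> t"
  shows "1 + t * q + t * (t + 1) / 2 * q\<^sup>2 + t * (t + 1) * (t + 2) / 6 * q ^ 3 \<le> (1 - q) powr (- t)"
proof -
  have mono: "f 0 \<le> f q" if "\<And>x. 0 \<le> x \<Longrightarrow> x \<le> q \<Longrightarrow> (f has_real_derivative f' x) (at x)"
    and "\<And>x. 0 \<le> x \<Longrightarrow> x \<le> q \<Longrightarrow> 0 \<le> f' x" and "0 \<le> q" for f f' :: "real \<Rightarrow> real" and q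
    by (rule DERIV_nonneg_imp_nondecreasing[OF that(3)]) (use that in blast)
  have der: "((\<lambda>x. (1 - x) powr (- s)) has_real_derivative s * (1 - x) powr (- (s + 1))) (at x)"
    if "x < 1" for x s :: real
  proof -
    have "- s - 1 = - (s + 1)" by simp
    then show ?thesis using that by (auto intro!: derivative_eq_intros)
  qed
  have 0: "1 \<le> (1 - q) powr (- s)" if "0 \<le> q" "q < 1" "0 \<le> s" for q s :: real
    using mono[of q "\<lambda>x. (1 - x) powr (- s)" "\<lambda>x. s * (1 - x) powr (- (s + 1))"] der that by auto
  have 1: "1 + s * q \<le> (1 - q) powr (- s)" if "0 \<le> q" "q < 1" "0 \<le> s" for q s :: real
  proof -
    let ?f = "\<lambda>x. (1 - x) powr (- s) - (1 + s * x)"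
    have "?f 0 \<le> ?f q"
    proof (rule mono)
      fix x assume x: "0 \<le> x" "x \<le> q"
      show "(?f has_real_derivative s * ((1 - x) powr (- (s + 1)) - 1)) (at x)"
        using x that by (auto intro!: derivative_eq_intros der[THEN DERIV_cong] simp: right_diff_distrib distrib_right)
      show "0 \<le> s * ((1 - x) powr (- (s + 1)) - 1)"
        using 0[of x "s + 1"] x that by simp
    qed fact
    then show ?thesis by simp
  qed
  have 2: "1 + s * q + s * (s + 1) / 2 * q\<^sup>2 \<le> (1 - q) powr (- s)" 
    if "0 \<le> q" "q < 1" "0 \<le> s" for q s :: real
  proof -
    let ?f = "\<lambda>x. (1 - x) powr (- s) - (1 + s * x + s * (s + 1) / 2 * x\<^sup>2)"
    have "?f 0 \<le> ?f q"
    proof (rule mono)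
      fix x assume x: "0 \<le> x" "x \<le> q"
      show "(?f has_real_derivative s * ((1 - x) powr (- (s + 1)) - (1 + (s + 1) * x))) (at x)"
        using x that by (auto intro!: derivative_eq_intros der[THEN DERIV_cong] simp: field_simps)
      show "0 \<le> s * ((1 - x) powr (- (s + 1)) - (1 + (s + 1) * x))"
        using 1[of x "s + 1"] x that by simp
    qed fact
    then show ?thesis by simp
  qed
  let ?f = "\<lambda>x. (1 - x) powr (- t) - (1 + t * x + t * (t + 1) / 2 * x\<^sup>2 + t * (t + 1) * (t + 2) / 6 * x ^ 3)"
  have "?f 0 \<le> ?f q"
  proof (rule mono)
    fix x assume x: "0 \<le> x" "x \<le> q"
    show "(?f has_real_derivative t * ((1 - x) powr (- (t + 1)) 
        - (1 + (t + 1) * x + (t + 1) * ((t + 1) + 1) / 2 * x\<^sup>2))) (at x)"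
      using x assms
      by (auto intro!: derivative_eq_intros der[THEN DERIV_cong] simp: field_simps power2_eq_square)
    show "0 \<le> t * ((1 - x) powr (- (t + 1)) - (1 + (t + 1) * x + (t + 1) * ((t + 1) + 1) / 2 * x\<^sup>2))"
      using 2[of x "t + 1"] x assms by simp
  qed fact
  then show ?thesis by simp
qed

lemma quadratic_form_nonneg:
  fixes A B C x y :: real
  assumes "0 < A" "B\<^sup>2 \<le> A * C"
  shows "0 \<le> A * x\<^sup>2 - 2 * B * x * y + C * y\<^sup>2"
proof -
  have "0 \<le> (A * x - B * y)\<^sup>2 + (A * C - B\<^sup>2) * y\<^sup>2"
    using assms by simp
  also have "\<dots> = A * (A * x\<^sup>2 - 2 * B * x * y + C * y\<^sup>2)"
    by algebra
  finally show ?thesis using assms(1) by (simp add: zero_le_mult_iff)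
qed

text \<open>Here \<open>L\<close> and \<open>T\<close> are the mean and the mean square of the first \<open>k\<close> eigenvalues, \<open>x\<close> is the next one and
\<open>q = 1/(k+1)\<close>. Adding a multiple of the hypothesis makes the difference of the two sides a quadratic
form in \<open>x\<close> and \<open>L\<close>, whose discriminant has the right sign by the Taylor bound for \<open>(1 - q)^(-2s)\<close>.\<close>

lemma cheng_yang_step:
  fixes s q L T x :: real
  assumes s: "0 < s" and q: "0 < q" "q \<le> 1 / 2"
    and yang: "x\<^sup>2 - 2 * (1 + s) * L * x + (1 + 2 * s) * T \<le> 0"
  shows "(1 + s) * ((1 - q) * L + q * x)\<^sup>2 - ((1 - q) * T + q * x\<^sup>2)
    \<le> (1 - q) powr (- (2 * s)) * ((1 + s) * L\<^sup>2 - T)"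
proof -
  define c where "c = (1 - q) powr (- (2 * s))"
  \<comment> \<open>\<open>\<delta>\<close> is the multiple of the hypothesis that cancels
    \<open>T\<close> from the difference of the two sides. \<open>\<epsilon>\<close> is the same
    expression with \<open>c\<close> replaced by its cubic Taylor bound.\<close>
  define \<delta> where "\<delta> = (c - 1 + q) / (1 + 2 * s)"
  define \<epsilon> where "\<epsilon> = q + s * q\<^sup>2 + 2 * s * (s + 1) / 3 * q ^ 3"
  have c\<delta>: "c - 1 + q = (1 + 2 * s) * \<delta>" using s by (simp add: \<delta>_def)
  have \<epsilon>: "\<epsilon> \<le> \<delta>"
  proof -
    have "1 + (2 * s) * q + (2 * s) * ((2 * s) + 1) / 2 * q\<^sup>2 + (2 * s) * ((2 * s) + 1) * ((2 * s) + 2) / 6 * q ^ 3 \<le> c"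
      unfolding c_def using one_minus_powr_neg_lower_bound[of q "2 * s"] s q by simp
    moreover have "1 + (2 * s) * q + (2 * s) * ((2 * s) + 1) / 2 * q\<^sup>2 + (2 * s) * ((2 * s) + 1) * ((2 * s) + 2) / 6 * q ^ 3
        = (1 + 2 * s) * \<epsilon> + 1 - q"
      unfolding \<epsilon>_def by (simp add: field_simps power2_eq_square power3_eq_cube)
    ultimately have "(1 + 2 * s) * \<epsilon> \<le> (1 + 2 * s) * \<delta>" using c\<delta> by linarith
    then show ?thesis using s by simp
  qed
  have q2: "q\<^sup>2 \<le> q" using q by (simp add: power2_eq_square mult_left_le)
  have \<epsilon>_ge: "q + s * q\<^sup>2 \<le> \<epsilon>" unfolding \<epsilon>_def using s q by simp
  \<comment> \<open>Stopping at the quadratic Taylor term would leave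
    \<open>- s * (1 + s) * q ^ 4\<close>; the cubic term adds \<open>4 / 3\<close> of that amount
    and turns the sign. The factor \<open>1 - 2 * q\<close> is where \<open>q \<le> 1 / 2\<close> is
    used.\<close>
  have disc0: "0 \<le> \<epsilon>\<^sup>2 - q\<^sup>2 * (1 + 2 * s) * \<epsilon> - q\<^sup>2 * (1 - q)"
  proof -
    have "\<epsilon>\<^sup>2 - q\<^sup>2 * (1 + 2 * s) * \<epsilon> - q\<^sup>2 * (1 - q)
        = q\<^sup>2 * (s * (s + 1) * (q\<^sup>2 / 3 * (1 - 2 * q) + 4 / 9 * s * (s + 1) * q ^ 4))"
      unfolding \<epsilon>_def by (simp add: field_simps eval_nat_numeral)
    also have "\<dots> \<ge> 0" using s q by (intro mult_nonneg_nonneg add_nonneg_nonneg) auto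
    finally show ?thesis .
  qed
  \<comment> \<open>The polynomial is increasing in its argument from \<open>\<epsilon>\<close> on,
    so nonnegativity passes from \<open>\<epsilon>\<close> to \<open>\<delta>\<close>.\<close>
  have disc: "0 \<le> \<delta>\<^sup>2 - q\<^sup>2 * (1 + 2 * s) * \<delta> - q\<^sup>2 * (1 - q)"
  proof -
    have "\<delta>\<^sup>2 - q\<^sup>2 * (1 + 2 * s) * \<delta> - (\<epsilon>\<^sup>2 - q\<^sup>2 * (1 + 2 * s) * \<epsilon>)
        = (\<delta> - \<epsilon>) * (\<delta> + \<epsilon> - q\<^sup>2 * (1 + 2 * s))"
      by algebra
    moreover have "0 \<le> \<delta> + \<epsilon> - q\<^sup>2 * (1 + 2 * s)"
      using \<epsilon> \<epsilon>_ge q2 q by (simp add: algebra_simps)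
    then have "0 \<le> (\<delta> - \<epsilon>) * (\<delta> + \<epsilon> - q\<^sup>2 * (1 + 2 * s))"
      using \<epsilon> by (intro mult_nonneg_nonneg) auto
    ultimately show ?thesis using disc0 by linarith
  qed
  \<comment> \<open>The coefficients of the quadratic form in \<open>x\<close> and \<open>L\<close>
    that remains after \<open>T\<close> has been cancelled; \<open>A * C - B\<^sup>2\<close> is
    \<open>s * (1 + s)\<close> times the polynomial in \<open>disc\<close>.\<close>
  define A where "A = \<delta> + q - q\<^sup>2 * (1 + s)"
  define B where "B = (1 + s) * (\<delta> + q * (1 - q))"
  define C where "C = (1 + s) * ((1 + 2 * s) * \<delta> + q * (1 - q))"
  have "A * C - B\<^sup>2 = (1 + s) * s * (\<delta>\<^sup>2 - q\<^sup>2 * (1 + 2 * s) * \<delta> - q\<^sup>2 * (1 - q))"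
    unfolding A_def B_def C_def by algebra
  also have "\<dots> \<ge> 0" using s disc by simp
  finally have BAC: "B\<^sup>2 \<le> A * C" by simp
  have "0 < A" unfolding A_def using \<epsilon> \<epsilon>_ge q2 q by (simp add: algebra_simps)
  from quadratic_form_nonneg[OF this BAC] have form: "0 \<le> A * x\<^sup>2 - 2 * B * x * L + C * L\<^sup>2" .
  have "0 < \<delta>" using \<epsilon> \<epsilon>_ge q s zero_less_power2[of q] mult_pos_pos[of s "q\<^sup>2"] by linarith
  then have "0 \<le> \<delta> * - (x\<^sup>2 - 2 * (1 + s) * L * x + (1 + 2 * s) * T)"
    using yang by (intro mult_nonneg_nonneg) auto
  moreover have "c * ((1 + s) * L\<^sup>2 - T) - ((1 + s) * ((1 - q) * L + q * x)\<^sup>2 - ((1 - q) * T + q * x\<^sup>2))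
      = (A * x\<^sup>2 - 2 * B * x * L + C * L\<^sup>2) + \<delta> * - (x\<^sup>2 - 2 * (1 + s) * L * x + (1 + 2 * s) * T)"
  proof -
    have c: "c = (1 + 2 * s) * \<delta> + 1 - q" using c\<delta> by linarith
    show ?thesis unfolding A_def B_def C_def c by algebra
  qed
  ultimately show ?thesis using form unfolding c_def[symmetric] by linarith
qed

text \<open>At \<open>q = 1 / (k + 1)\<close> the growth factor in \<open>cheng_yang_step\<close> is
  \<open>((k + 1) / k) powr (2 * s)\<close>, so the quotient of \<open>F k\<close> by
  \<open>k powr (2 * s)\<close> never exceeds its initial value
  \<open>s * (\<mu> 1)\<^sup>2\<close>. Yang's quadratic inequality then turns a bound on
  \<open>F k\<close> into one on \<open>\<mu> (k + 1)\<close>.\<close>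

lemma cheng_yang_recursion:
  fixes \<mu> :: "nat \<Rightarrow> real" and s :: real
  assumes s: "0 < s" and pos: "0 \<le> \<mu> 1" and k: "1 \<le> k"
    and yang: "\<And>k. 1 \<le> k \<Longrightarrow> (\<Sum>i=1..k. (\<mu> (k+1) - \<mu> i)\<^sup>2) \<le> 2 * s * (\<Sum>i=1..k. (\<mu> (k+1) - \<mu> i) * \<mu> i)"
  shows "\<mu> (k+1) \<le> (1 + 2 * s) * real k powr s * \<mu> 1"
proof -
  define L where "L k = (\<Sum>i=1..k. \<mu> i) / real k" for k
  define T where "T k = (\<Sum>i=1..k. (\<mu> i)\<^sup>2) / real k" for k
  define F where "F k = (1 + s) * (L k)\<^sup>2 - T k" for k
  have yang': "(\<mu> (k+1))\<^sup>2 - 2 * (1 + s) * L k * \<mu> (k+1) + (1 + 2 * s) * T k \<le> 0" if "1 \<le> k" for k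
  proof -
    have SL: "(\<Sum>i=1..k. \<mu> i) = real k * L k" and ST: "(\<Sum>i=1..k. (\<mu> i)\<^sup>2) = real k * T k"
      using that by (simp_all add: L_def T_def)
    let ?x = "\<mu> (k+1)"
    have "(\<Sum>i=1..k. (?x - \<mu> i)\<^sup>2) = real k * ?x\<^sup>2 - 2 * ?x * (\<Sum>i=1..k. \<mu> i) + (\<Sum>i=1..k. (\<mu> i)\<^sup>2)"
      by (simp add: power2_diff sum.distrib sum_subtractf sum_distrib_left mult_ac)
    moreover have "(\<Sum>i=1..k. (?x - \<mu> i) * \<mu> i) = ?x * (\<Sum>i=1..k. \<mu> i) - (\<Sum>i=1..k. (\<mu> i)\<^sup>2)"
      by (simp add: left_diff_distrib sum_subtractf sum_distrib_left power2_eq_square)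
    ultimately have "real k * (?x\<^sup>2 - 2 * (1 + s) * L k * ?x + (1 + 2 * s) * T k) \<le> 0"
      using yang[OF that] unfolding SL ST
      by (simp only:) (simp add: algebra_simps)
    then show ?thesis using that by (simp add: mult_le_0_iff)
  qed
  have F: "F k \<le> real k powr (2 * s) * (s * (\<mu> 1)\<^sup>2)" if "1 \<le> k" for k
    using that
  proof (induction k rule: dec_induct)
    case base
    then show ?case by (simp add: F_def L_def T_def algebra_simps)
  next
    case (step k)
    define q where "q = 1 / real (Suc k)"
    have q: "0 < q" "q \<le> 1 / 2" using step by (auto simp: q_def field_simps)
    have 1: "1 - q = real k / real (Suc k)" by (simp add: q_def field_simps)
    have L: "L (Suc k) = (1 - q) * L k + q * \<mu> (k+1)" and T: "T (Suc k) = (1 - q) * T k + q * (\<mu> (k+1))\<^sup>2"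
      using step unfolding 1 by (simp_all add: L_def T_def q_def add_divide_distrib)
    have "F (Suc k) \<le> (1 - q) powr (- (2 * s)) * F k"
      unfolding F_def L T by (rule cheng_yang_step[OF s q yang']) (use step in simp)
    also have "\<dots> \<le> (1 - q) powr (- (2 * s)) * (real k powr (2 * s) * (s * (\<mu> 1)\<^sup>2))"
      using step.IH by (intro mult_left_mono) auto
    also have "(1 - q) powr (- (2 * s)) = real (Suc k) powr (2 * s) / real k powr (2 * s)"
      unfolding 1 using step by (simp add: powr_divide powr_minus_divide)
    finally show ?case using step by simp
  qed
  let ?x = "\<mu> (k+1)"
  \<comment> \<open>The added square is the one that makes the right-hand side a combination of
    Yang's quadratic and \<open>F k\<close> alone.\<close>
  have "?x\<^sup>2 * s \<le> ?x\<^sup>2 * s + (1 + s) * ((1 + 2 * s) * L k - ?x)\<^sup>2" using s by simp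
  also have "\<dots> = (1 + 2 * s) * (?x\<^sup>2 - 2 * (1 + s) * L k * ?x + (1 + 2 * s) * T k) + (1 + 2 * s)\<^sup>2 * F k"
    unfolding F_def by algebra
  also have "\<dots> \<le> (1 + 2 * s)\<^sup>2 * F k"
    using yang'[OF k] s by (simp add: mult_nonneg_nonpos)
  also have "\<dots> \<le> (1 + 2 * s)\<^sup>2 * (real k powr (2 * s) * (s * (\<mu> 1)\<^sup>2))"
    using F[OF k] by (intro mult_left_mono) auto
  also have "\<dots> = ((1 + 2 * s) * real k powr s * \<mu> 1)\<^sup>2 * s"
  proof -
    have "real k powr (2 * s) = (real k powr s)\<^sup>2" by (simp add: power2_eq_square flip: powr_add)
    then show ?thesis by (simp add: power_mult_distrib)
  qed
  finally have "?x\<^sup>2 \<le> ((1 + 2 * s) * real k powr s * \<mu> 1)\<^sup>2" using s by simp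
  then show ?thesis by (rule power2_le_imp_le) (use s pos in auto)
qed

subsection \<open>Square-integrable functions and Parseval's identity\<close>

lemma L2_mult_integrable:
  assumes "L2 M f" "L2 M g"
  shows "integrable M (\<lambda>x. f x * g x)"
proof (rule Bochner_Integration.integrable_bound)
  show "integrable M (\<lambda>x. (f x)\<^sup>2 + (g x)\<^sup>2)"
    using assms by (simp add: L2_def)
  show "(\<lambda>x. f x * g x) \<in> borel_measurable M"
    using assms by (auto simp: L2_def)
  have "\<bar>a * b\<bar> \<le> a\<^sup>2 + b\<^sup>2" for a b :: real
  proof -
    have "2 * \<bar>a * b\<bar> \<le> a\<^sup>2 + b\<^sup>2"
      using sum_squares_bound[of "\<bar>a\<bar>" "\<bar>b\<bar>"] by (simp add: abs_mult)
    then show ?thesis using abs_ge_zero[of "a * b"] by linarith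
  qed
  then show "AE x in M. norm (f x * g x) \<le> norm ((f x)\<^sup>2 + (g x)\<^sup>2)"
    by (auto simp: abs_mult)
qed

lemma L2_cmult: "L2 M f \<Longrightarrow> L2 M (\<lambda>x. c * f x)"
  by (auto simp: L2_def power_mult_distrib)

lemma L2_add:
  assumes "L2 M f" "L2 M g"
  shows "L2 M (\<lambda>x. f x + g x)"
  using assms L2_mult_integrable[OF assms] by (auto simp: L2_def power2_sum mult.assoc)

lemma L2_diff:
  assumes "L2 M f" "L2 M g"
  shows "L2 M (\<lambda>x. f x - g x)"
  using assms L2_mult_integrable[OF assms] by (auto simp: L2_def power2_diff mult.assoc)

lemma L2_zero: "L2 M (\<lambda>x. 0)"
  by (simp add: L2_def)

lemma L2_sum: "(\<And>i. i \<in> I \<Longrightarrow> L2 M (f i)) \<Longrightarrow> L2 M (\<lambda>x. \<Sum>i\<in>I. f i x)"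
  by (induction I rule: infinite_finite_induct) (auto intro: L2_zero L2_add)

lemma L2_mult_bounded:
  assumes "L2 M f" "g \<in> borel_measurable M" "\<And>x. x \<in> space M \<Longrightarrow> \<bar>g x\<bar> \<le> C"
  shows "L2 M (\<lambda>x. g x * f x)"
  unfolding L2_def
proof
  show "(\<lambda>x. g x * f x) \<in> borel_measurable M" using assms by (auto simp: L2_def)
  show "integrable M (\<lambda>x. (g x * f x)\<^sup>2)"
  proof (rule Bochner_Integration.integrable_bound)
    show "integrable M (\<lambda>x. C\<^sup>2 * (f x)\<^sup>2)" using assms by (simp add: L2_def)
    show "(\<lambda>x. (g x * f x)\<^sup>2) \<in> borel_measurable M" using assms by (auto simp: L2_def)
    have "(g x)\<^sup>2 \<le> C\<^sup>2" if "x \<in> space M" for x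
      using assms(3)[OF that] power_mono[of "\<bar>g x\<bar>" C 2] by simp
    then show "AE x in M. norm ((g x * f x)\<^sup>2) \<le> norm (C\<^sup>2 * (f x)\<^sup>2)"
      by (auto simp: power_mult_distrib intro!: mult_right_mono)
  qed
qed

lemma L2_bounded:
  assumes "finite_measure M" "f \<in> borel_measurable M" "\<And>x. x \<in> space M \<Longrightarrow> \<bar>f x\<bar> \<le> C"
  shows "L2 M f"
proof -
  have "L2 M (\<lambda>x. 1)" using assms(1) by (simp add: L2_def finite_measure.integrable_const)
  from L2_mult_bounded[OF this assms(2,3)] show ?thesis by simp
qed

lemma L2_cauchy_schwarz:
  assumes "L2 M f" "L2 M g"
  shows "(\<integral>x. f x * g x \<partial>M)\<^sup>2 \<le> (\<integral>x. (f x)\<^sup>2 \<partial>M) * (\<integral>x. (g x)\<^sup>2 \<partial>M)"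
proof -
  let ?A = "\<integral>x. (g x)\<^sup>2 \<partial>M" and ?B = "\<integral>x. f x * g x \<partial>M" and ?C = "\<integral>x. (f x)\<^sup>2 \<partial>M"
  have int: "integrable M (\<lambda>x. (f x)\<^sup>2)" "integrable M (\<lambda>x. (g x)\<^sup>2)" "integrable M (\<lambda>x. f x * g x)"
    using assms L2_mult_integrable by (auto simp: L2_def)
  have q: "0 \<le> ?C + 2 * t * ?B + t\<^sup>2 * ?A" for t
  proof -
    have "0 \<le> (\<integral>x. (f x + t * g x)\<^sup>2 \<partial>M)" by simp
    also have "\<dots> = (\<integral>x. (f x)\<^sup>2 + 2 * t * (f x * g x) + t\<^sup>2 * (g x)\<^sup>2 \<partial>M)"
      by (rule Bochner_Integration.integral_cong) (auto simp: power2_eq_square algebra_simps)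
    also have "\<dots> = ?C + 2 * t * ?B + t\<^sup>2 * ?A" using int by simp
    finally show ?thesis .
  qed
  have A: "0 \<le> ?A" by simp
  show ?thesis
  proof (cases "?A = 0")
    case True
    have "?B = 0"
    proof (rule ccontr)
      assume "?B \<noteq> 0"
      \<comment> \<open>With \<open>?A = 0\<close> the quadratic in \<open>t\<close> is affine; this
        is the \<open>t\<close> at which it takes the forbidden value -1.\<close>
      then have "?C + 2 * (- (?C + 1) / (2 * ?B)) * ?B = - 1" by (simp add: field_simps)
      with q[of "- (?C + 1) / (2 * ?B)"] True show False by simp
    qed
    then show ?thesis by simp
  next
    case False
    then have "0 < ?A" using A by linarith
    have "0 \<le> ?A * (?C + 2 * (- ?B / ?A) * ?B + (- ?B / ?A)\<^sup>2 * ?A)"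
      using q[of "- ?B / ?A"] A by (rule mult_nonneg_nonneg[rotated])
    also have "\<dots> = ?C * ?A - ?B\<^sup>2" using False by (simp add: field_simps power2_eq_square)
    finally show ?thesis by simp
  qed
qed

lemma L2_tendsto_inner:
  assumes "\<And>n. L2 M (fs n)" "L2 M f" "L2 M h"
    and lim: "(\<lambda>n. \<integral>x. (fs n x - f x)\<^sup>2 \<partial>M) \<longlonglongrightarrow> 0"
  shows "(\<lambda>n. \<integral>x. fs n x * h x \<partial>M) \<longlonglongrightarrow> (\<integral>x. f x * h x \<partial>M)"
proof (rule Lim_transform2[OF tendsto_const])
  have "(\<lambda>n. (\<integral>x. (fs n x - f x) * h x \<partial>M)\<^sup>2) \<longlonglongrightarrow> 0"
  proof (rule tendsto_sandwich[OF _ _ tendsto_const])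
    show "(\<lambda>n. (\<integral>x. (fs n x - f x)\<^sup>2 \<partial>M) * (\<integral>x. (h x)\<^sup>2 \<partial>M)) \<longlonglongrightarrow> 0"
      using tendsto_mult_left_zero[OF lim] .
  qed (auto intro!: always_eventually L2_cauchy_schwarz L2_diff assms)
  then have "(\<lambda>n. \<integral>x. (fs n x - f x) * h x \<partial>M) \<longlonglongrightarrow> 0"
    using tendsto_real_sqrt[of _ 0] by (force simp: tendsto_rabs_zero_iff)
  moreover have "(\<integral>x. (fs n x - f x) * h x \<partial>M) = (\<integral>x. fs n x * h x \<partial>M) - (\<integral>x. f x * h x \<partial>M)" for n
    using L2_mult_integrable[OF assms(1,3)] L2_mult_integrable[OF assms(2,3)] 
    by (simp add: left_diff_distrib)
  ultimately show "(\<lambda>n. (\<integral>x. f x * h x \<partial>M) - (\<integral>x. fs n x * h x \<partial>M)) \<longlonglongrightarrow> 0"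
    using tendsto_minus by fastforce
qed

text \<open>Along a subsequence with squared increments below \<open>(1/8)^k\<close> the weighted sum
\<open>\<Sum> 4^k (g (k+1) - g k)\<^sup>2\<close> is integrable, which forces pointwise convergence almost everywhere.\<close>

lemma L2_complete:
  fixes fs :: "nat \<Rightarrow> 'a \<Rightarrow> real"
  assumes L2: "\<And>n. L2 M (fs n)"
    and Cauchy: "\<And>e. 0 < e \<Longrightarrow> \<exists>K. \<forall>m\<ge>K. \<forall>n\<ge>K. (\<integral>x. (fs m x - fs n x)\<^sup>2 \<partial>M) \<le> e"
  obtains f where "L2 M f" "(\<lambda>n. \<integral>x. (fs n x - f x)\<^sup>2 \<partial>M) \<longlonglongrightarrow> 0"
proof -
  have meas [measurable]: "fs n \<in> borel_measurable M" for n using L2 by (simp add: L2_def)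
  have nn: "(\<integral>\<^sup>+x. ennreal ((fs m x - fs n x)\<^sup>2) \<partial>M) = ennreal (\<integral>x. (fs m x - fs n x)\<^sup>2 \<partial>M)" for m n
    using L2_diff[OF L2 L2] by (intro nn_integral_eq_integral) (auto simp: L2_def)
  have "\<exists>r. strict_mono r \<and> (\<forall>k. \<forall>m\<ge>r k. \<forall>n\<ge>r k. (\<integral>x. (fs m x - fs n x)\<^sup>2 \<partial>M) \<le> (1/8) ^ k)"
  proof -
    have "\<forall>k. \<exists>K. \<forall>m\<ge>K. \<forall>n\<ge>K. (\<integral>x. (fs m x - fs n x)\<^sup>2 \<partial>M) \<le> (1/8::real) ^ k"
      by (intro allI Cauchy) simp
    then obtain K where K: "\<And>k m n. m \<ge> K k \<Longrightarrow> n \<ge> K k \<Longrightarrow> (\<integral>x. (fs m x - fs n x)\<^sup>2 \<partial>M) \<le> (1/8::real) ^ k"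
      unfolding choice_iff by blast
    \<comment> \<open>Summing the thresholds, each increased by 1, makes the indices strictly
      increasing and keeps \<open>r k\<close> above \<open>K k\<close>.\<close>
    define r where "r k = (\<Sum>i\<le>k. K i + 1)" for k
    have "K k \<le> r k" for k unfolding r_def
      by (rule order_trans[OF _ member_le_sum[of k]]) auto
    moreover have "strict_mono r" by (rule strict_monoI_Suc) (simp add: r_def)
    ultimately show ?thesis by (intro exI[of _ r] conjI allI impI K) (auto intro: order_trans)
  qed
  then obtain r where r: "strict_mono r" 
    "\<And>k m n. m \<ge> r k \<Longrightarrow> n \<ge> r k \<Longrightarrow> (\<integral>x. (fs m x - fs n x)\<^sup>2 \<partial>M) \<le> (1/8) ^ k" by blast
  define g where "g k = fs (r k)" for k
  have [measurable]: "g k \<in> borel_measurable M" for k by (simp add: g_def)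
  have "AE x in M. (\<Sum>k. ennreal (4 ^ k * (g (Suc k) x - g k x)\<^sup>2)) \<noteq> \<infinity>"
  proof (rule nn_integral_PInf_AE)
    have "(\<integral>\<^sup>+x. (\<Sum>k. ennreal (4 ^ k * (g (Suc k) x - g k x)\<^sup>2)) \<partial>M) 
        = (\<Sum>k. \<integral>\<^sup>+x. ennreal (4 ^ k * (g (Suc k) x - g k x)\<^sup>2) \<partial>M)"
      by (rule nn_integral_suminf) simp
    also have "\<dots> \<le> (\<Sum>k. ennreal ((1/2) ^ k))"
    proof (rule suminf_le)
      fix k
      have "r k \<le> r (Suc k)" using r(1) by (simp add: strict_mono_less_eq)
      have "(\<integral>\<^sup>+x. ennreal (4 ^ k * (g (Suc k) x - g k x)\<^sup>2) \<partial>M) 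
          = ennreal (4 ^ k) * (\<integral>\<^sup>+x. ennreal ((g (Suc k) x - g k x)\<^sup>2) \<partial>M)"
        by (simp add: ennreal_mult nn_integral_cmult)
      also have "\<dots> = ennreal (4 ^ k * (\<integral>x. (g (Suc k) x - g k x)\<^sup>2 \<partial>M))"
        unfolding g_def nn by (simp add: ennreal_mult)
      also have "\<dots> \<le> ennreal (4 ^ k * (1/8) ^ k)"
        unfolding g_def using r(2)[of k] \<open>r k \<le> r (Suc k)\<close>
        by (intro ennreal_leI mult_left_mono) auto
      also have "4 ^ k * (1/8) ^ k = (1/2::real) ^ k" by (simp flip: power_mult_distrib)
      finally show "(\<integral>\<^sup>+x. ennreal (4 ^ k * (g (Suc k) x - g k x)\<^sup>2) \<partial>M) \<le> ennreal ((1/2) ^ k)" .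
    qed auto
    also have "\<dots> = ennreal (\<Sum>k. (1/2) ^ k)"
      by (rule suminf_ennreal2) (auto intro: summable_geometric)
    also have "\<dots> < \<infinity>" by simp
    finally show "(\<integral>\<^sup>+x. (\<Sum>k. ennreal (4 ^ k * (g (Suc k) x - g k x)\<^sup>2)) \<partial>M) \<noteq> \<infinity>" by simp
  qed simp
  then have conv: "AE x in M. convergent (\<lambda>k. g k x)"
  proof eventually_elim
    fix x assume "(\<Sum>k. ennreal (4 ^ k * (g (Suc k) x - g k x)\<^sup>2)) \<noteq> \<infinity>"
    then have sm: "summable (\<lambda>k. 4 ^ k * (g (Suc k) x - g k x)\<^sup>2)"
      by (intro summable_suminf_not_top) (auto simp: infinity_ennreal_def)
    define C where "C = (\<Sum>k. 4 ^ k * (g (Suc k) x - g k x)\<^sup>2)"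
    have "norm (g (Suc k) x - g k x) \<le> sqrt C * (1/2) ^ k" for k
    proof -
      have "4 ^ k * (g (Suc k) x - g k x)\<^sup>2 \<le> C"
        unfolding C_def using sum_le_suminf[OF sm, of "{k}"] by simp
      then have "(2 ^ k * (g (Suc k) x - g k x))\<^sup>2 \<le> C"
        by (simp add: power_mult_distrib power2_eq_square[of "2 ^ k"] flip: power_mult_distrib[of 2 2])
      then have "2 ^ k * \<bar>g (Suc k) x - g k x\<bar> \<le> sqrt C"
        using real_le_rsqrt[of "2 ^ k * \<bar>g (Suc k) x - g k x\<bar>" C] by (simp add: power_mult_distrib)
      then show ?thesis by (simp add: field_simps power_one_over)
    qed
    note le = this
    have "summable (\<lambda>k. sqrt C * (1/2) ^ k)"
      by (intro summable_mult summable_geometric) simp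
    then have "summable (\<lambda>k. g (Suc k) x - g k x)"
      by (rule summable_comparison_test'[where N = 0]) (rule le)
    from summable_LIMSEQ[OF this] have "convergent (\<lambda>k. g k x - g 0 x)"
      unfolding sum_lessThan_telescope[of "\<lambda>k. g k x"] by (auto simp: convergent_def)
    then show "convergent (\<lambda>k. g k x)" by (simp add: convergent_diff_const_right_iff)
  qed
  define f where "f x = lim (\<lambda>k. g k x)" for x
  have [measurable]: "f \<in> borel_measurable M" unfolding f_def by measurable
  \<comment> \<open>Fatou's lemma along the subsequence carries the Cauchy bound over to the limit
    for every \<open>n \<ge> r k\<close>, so the whole sequence converges and not only the
    subsequence.\<close>
  have bound: "(\<integral>\<^sup>+x. ennreal ((fs n x - f x)\<^sup>2) \<partial>M) \<le> ennreal ((1/8) ^ k)" if "r k \<le> n" for n k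
  proof -
    have "(\<integral>\<^sup>+x. ennreal ((fs n x - f x)\<^sup>2) \<partial>M) 
        = (\<integral>\<^sup>+x. liminf (\<lambda>m. ennreal ((fs n x - g m x)\<^sup>2)) \<partial>M)"
    proof (rule nn_integral_cong_AE, use conv in eventually_elim)
      fix x assume "convergent (\<lambda>k. g k x)"
      then have "(\<lambda>k. g k x) \<longlonglongrightarrow> f x" by (simp add: f_def convergent_LIMSEQ_iff)
      then have "(\<lambda>m. ennreal ((fs n x - g m x)\<^sup>2)) \<longlonglongrightarrow> ennreal ((fs n x - f x)\<^sup>2)"
        by (intro tendsto_intros)
      from lim_imp_Liminf[OF _ this]
      show "ennreal ((fs n x - f x)\<^sup>2) = liminf (\<lambda>m. ennreal ((fs n x - g m x)\<^sup>2))" by simp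
    qed
    also have "\<dots> \<le> liminf (\<lambda>m. \<integral>\<^sup>+x. ennreal ((fs n x - g m x)\<^sup>2) \<partial>M)"
      by (rule nn_integral_liminf) simp
    also have "\<dots> \<le> liminf (\<lambda>m::nat. ennreal ((1/8) ^ k))"
    proof (rule Liminf_mono, rule eventually_sequentiallyI[of k])
      fix m assume "k \<le> m"
      then have "r k \<le> r m" using r(1) by (simp add: strict_mono_less_eq)
      then show "(\<integral>\<^sup>+x. ennreal ((fs n x - g m x)\<^sup>2) \<partial>M) \<le> ennreal ((1/8) ^ k)"
        unfolding g_def nn using r(2)[of k] that by (intro ennreal_leI) auto
    qed
    also have "\<dots> = ennreal ((1/8) ^ k)" by (rule Liminf_const) simp
    finally show ?thesis .
  qed
  \<comment> \<open>The case \<open>k = 0\<close> of \<open>bound\<close> already puts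
    \<open>f\<close> at finite distance from a square-integrable function.\<close>
  have L2d: "L2 M (\<lambda>x. fs (r 0) x - f x)"
    unfolding L2_def using order_le_less_trans[OF bound[of 0 "r 0"] ennreal_less_top]
    by (auto intro!: integrableI_nonneg)
  have L2f: "L2 M f" using L2_diff[OF L2 L2d, of "r 0"] by simp
  have "(\<lambda>n. \<integral>x. (fs n x - f x)\<^sup>2 \<partial>M) \<longlonglongrightarrow> 0"
  proof (rule LIMSEQ_I)
    fix e :: real assume "0 < e"
    then obtain k where k: "(1/8) ^ k < e" using real_arch_pow_inv[of e "1/8"] by auto
    have "norm ((\<integral>x. (fs n x - f x)\<^sup>2 \<partial>M) - 0) < e" if "r k \<le> n" for n
    proof -
      have "(\<integral>\<^sup>+x. ennreal ((fs n x - f x)\<^sup>2) \<partial>M) = ennreal (\<integral>x. (fs n x - f x)\<^sup>2 \<partial>M)"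
        using L2_diff[OF L2 L2f] by (intro nn_integral_eq_integral) (auto simp: L2_def)
      with bound[OF that] have "(\<integral>x. (fs n x - f x)\<^sup>2 \<partial>M) \<le> (1/8) ^ k" by (simp add: ennreal_le_iff)
      then show ?thesis using k by simp
    qed
    then show "\<exists>N. \<forall>n\<ge>N. norm ((\<integral>x. (fs n x - f x)\<^sup>2 \<partial>M) - 0) < e" by blast
  qed
  with L2f show thesis by (rule that)
qed

section \<open>Complete orthonormal systems: Bessel's inequality, expansion and Parseval's
  identity\<close>

locale complete_orthonormal =
  fixes M :: "'a measure" and e :: "nat \<Rightarrow> 'a \<Rightarrow> real"
  assumes L2_e: "1 \<le> l \<Longrightarrow> L2 M (e l)"
    and orthonormal: "1 \<le> i \<Longrightarrow> 1 \<le> l \<Longrightarrow> (\<integral>x. e i x * e l x \<partial>M) = (if i = l then 1 else 0)"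
    and complete: "L2 M f \<Longrightarrow> (\<And>l. 1 \<le> l \<Longrightarrow> (\<integral>x. f x * e l x \<partial>M) = 0) \<Longrightarrow> AE x in M. f x = 0"
begin

lemma inner_sum:
  assumes "finite I" "\<And>l. l \<in> I \<Longrightarrow> 1 \<le> l" "L2 M h"
  shows "(\<integral>x. (\<Sum>l\<in>I. c l * e l x) * h x \<partial>M) = (\<Sum>l\<in>I. c l * (\<integral>x. h x * e l x \<partial>M))"
proof -
  have "integrable M (\<lambda>x. e l x * h x)" if "l \<in> I" for l
    using assms that by (intro L2_mult_integrable L2_e) auto
  then show ?thesis
    by (simp add: sum_distrib_right mult.assoc Bochner_Integration.integral_sum mult.commute[of "h _"])
qed

lemma L2_combination: "(\<And>l. l \<in> I \<Longrightarrow> 1 \<le> l) \<Longrightarrow> L2 M (\<lambda>x. \<Sum>l\<in>I. c l * e l x)"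
  by (intro L2_sum L2_cmult L2_e)

lemma norm_sum:
  assumes I: "finite I" "\<And>l. l \<in> I \<Longrightarrow> 1 \<le> l"
  shows "(\<integral>x. (\<Sum>l\<in>I. c l * e l x)\<^sup>2 \<partial>M) = (\<Sum>l\<in>I. (c l)\<^sup>2)"
proof -
  have coef: "(\<integral>x. (\<Sum>i\<in>I. c i * e i x) * e l x \<partial>M) = c l" if "l \<in> I" for l
  proof -
    have "(\<integral>x. (\<Sum>i\<in>I. c i * e i x) * e l x \<partial>M) = (\<Sum>i\<in>I. c i * (if l = i then 1 else 0))"
      using inner_sum[OF I L2_e, of l] I(2) that by (simp add: orthonormal cong: sum.cong)
    also have "\<dots> = (\<Sum>i\<in>I. if l = i then c i else 0)" by (rule sum.cong) auto
    finally show ?thesis using that I(1) by simp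
  qed
  have "L2 M (\<lambda>x. \<Sum>l\<in>I. c l * e l x)" by (rule L2_combination[OF I(2)])
  from inner_sum[OF I this, of c] coef show ?thesis by (simp add: power2_eq_square)
qed

lemma bessel:
  assumes "L2 M f"
  shows "(\<Sum>l=1..N. (\<integral>x. f x * e l x \<partial>M)\<^sup>2) \<le> (\<integral>x. (f x)\<^sup>2 \<partial>M)"
proof -
  define c where "c l = (\<integral>x. f x * e l x \<partial>M)" for l
  define S where "S x = (\<Sum>l\<in>{1..N}. c l * e l x)" for x
  have L2S: "L2 M S" unfolding S_def by (rule L2_combination) simp
  have Sf: "(\<integral>x. S x * f x \<partial>M) = (\<Sum>l=1..N. (c l)\<^sup>2)"
    unfolding S_def using inner_sum[of "{1..N}" f c] assms by (simp add: c_def power2_eq_square)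
  have SS: "(\<integral>x. (S x)\<^sup>2 \<partial>M) = (\<Sum>l=1..N. (c l)\<^sup>2)"
    unfolding S_def by (rule norm_sum) auto
  have int: "integrable M (\<lambda>x. (f x)\<^sup>2)" "integrable M (\<lambda>x. (S x)\<^sup>2)" "integrable M (\<lambda>x. S x * f x)"
    using assms L2S L2_mult_integrable by (auto simp: L2_def)
  have "0 \<le> (\<integral>x. (f x - S x)\<^sup>2 \<partial>M)" by simp
  also have "\<dots> = (\<integral>x. (f x)\<^sup>2 + (S x)\<^sup>2 - 2 * (S x * f x) \<partial>M)"
    by (simp add: power2_diff mult_ac)
  also have "\<dots> = (\<integral>x. (f x)\<^sup>2 \<partial>M) - (\<Sum>l=1..N. (c l)\<^sup>2)"
    using int by (simp add: Sf SS)
  finally show ?thesis by (simp add: c_def)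
qed

text \<open>Completeness is given only as triviality of the orthogonal complement. Bessel's
  inequality makes the partial sums Cauchy, \<open>L2_complete\<close> supplies a limit
  \<open>h\<close>, and \<open>f - h\<close> is orthogonal to every \<open>e l\<close>, hence zero
  almost everywhere.\<close>

lemma expansion_tendsto:
  assumes f: "L2 M f"
  shows "(\<lambda>N. \<integral>x. ((\<Sum>l=1..N. (\<integral>y. f y * e l y \<partial>M) * e l x) - f x)\<^sup>2 \<partial>M) \<longlonglongrightarrow> 0"
proof -
  define c where "c l = (\<integral>x. f x * e l x \<partial>M)" for l
  define S where "S N x = (\<Sum>l=1..N. c l * e l x)" for N x
  have L2S: "L2 M (S N)" for N unfolding S_def by (rule L2_combination) simp
  have "summable (\<lambda>l. (c (Suc l))\<^sup>2)"
  proof (rule summableI_nonneg_bounded)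
    show "(\<Sum>l<N. (c (Suc l))\<^sup>2) \<le> (\<integral>x. (f x)\<^sup>2 \<partial>M)" for N
      using bessel[OF f, of N] unfolding c_def
      by (simp add: sum.atLeast1_atMost_eq)
  qed simp
  then have Cau: "\<exists>K. \<forall>m\<ge>K. \<forall>n. norm (\<Sum>l\<in>{m..<n}. (c (Suc l))\<^sup>2) < d" if "0 < d" for d :: real
    using that by (simp add: summable_Cauchy)
  have diff: "(\<integral>x. (S n x - S m x)\<^sup>2 \<partial>M) = (\<Sum>l\<in>{m..<n}. (c (Suc l))\<^sup>2)" if "m \<le> n" for m n
  proof -
    have "{1..n} = {1..m} \<union> {m<..n}" using that by auto
    then have "S n x - S m x = (\<Sum>l\<in>{m<..n}. c l * e l x)" for x
      by (simp add: S_def sum.union_disjoint ivl_disj_int)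
    then have "(\<integral>x. (S n x - S m x)\<^sup>2 \<partial>M) = (\<Sum>l\<in>{m<..n}. (c l)\<^sup>2)"
      using norm_sum[of "{m<..n}" c] by simp
    also have "{m<..n} = Suc ` {m..<n}" by (simp add: image_Suc_atLeastLessThan atLeastLessThanSuc_atLeastAtMost atLeastSucAtMost_greaterThanAtMost)
    also have "(\<Sum>l\<in>Suc ` {m..<n}. (c l)\<^sup>2) = (\<Sum>l\<in>{m..<n}. (c (Suc l))\<^sup>2)"
      by (subst sum.reindex) (auto simp: o_def)
    finally show ?thesis .
  qed
  have "\<exists>K. \<forall>m\<ge>K. \<forall>n\<ge>K. (\<integral>x. (S m x - S n x)\<^sup>2 \<partial>M) \<le> d" if d: "0 < d" for d
  proof -
    obtain K where K: "\<And>m n. m \<ge> K \<Longrightarrow> norm (\<Sum>l\<in>{m..<n}. (c (Suc l))\<^sup>2) < d" using Cau[OF d] by blast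
    have "(\<integral>x. (S m x - S n x)\<^sup>2 \<partial>M) \<le> d" if "m \<ge> K" "n \<ge> K" for m n
    proof (cases "m \<le> n")
      case True
      then show ?thesis using K[OF that(1), of n] diff[OF True] by (simp add: power2_commute[of "S m _"])
    next
      case False
      then show ?thesis using K[OF that(2), of m] diff[of n m] by simp
    qed
    then show ?thesis by blast
  qed
  from L2_complete[OF L2S this] obtain h where h: "L2 M h" and lim: "(\<lambda>N. \<integral>x. (S N x - h x)\<^sup>2 \<partial>M) \<longlonglongrightarrow> 0"
    by blast
  have "AE x in M. f x - h x = 0"
  proof (rule complete)
    show "L2 M (\<lambda>x. f x - h x)" using f h by (rule L2_diff)
    fix l :: nat assume l: "1 \<le> l"
    have "(\<lambda>N. \<integral>x. S N x * e l x \<partial>M) \<longlonglongrightarrow> (\<integral>x. h x * e l x \<partial>M)"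
      using L2S h L2_e[OF l] lim by (rule L2_tendsto_inner)
    moreover have "(\<lambda>N. \<integral>x. S N x * e l x \<partial>M) \<longlonglongrightarrow> c l"
    proof (rule tendsto_eventually, rule eventually_sequentiallyI[of l])
      fix N assume "l \<le> N"
      have "(\<integral>x. S N x * e l x \<partial>M) = (\<Sum>i=1..N. c i * (if l = i then 1 else 0))"
        unfolding S_def by (subst inner_sum) (use l in \<open>auto simp: orthonormal L2_e intro!: sum.cong\<close>)
      also have "\<dots> = (\<Sum>i=1..N. if l = i then c i else 0)" by (rule sum.cong) auto
      finally show "(\<integral>x. S N x * e l x \<partial>M) = c l" using l \<open>l \<le> N\<close> by simp
    qed
    ultimately have "(\<integral>x. h x * e l x \<partial>M) = c l" by (rule LIMSEQ_unique)
    then show "(\<integral>x. (f x - h x) * e l x \<partial>M) = 0"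
      using L2_mult_integrable[OF f L2_e[OF l]] L2_mult_integrable[OF h L2_e[OF l]] 
      by (simp add: left_diff_distrib c_def)
  qed
  then have "(\<integral>x. (S N x - h x)\<^sup>2 \<partial>M) = (\<integral>x. (S N x - f x)\<^sup>2 \<partial>M)" for N
    using L2S[of N] f h by (intro integral_cong_AE) (auto simp: L2_def elim: eventually_mono)
  then show ?thesis using lim unfolding S_def c_def by simp
qed

text \<open>The polarised form is needed: the two functions will be \<open>g u i\<close> and
  \<open>X j u i\<close>.\<close>

theorem parseval:
  assumes "L2 M f" "L2 M h"
  shows "(\<lambda>N. \<Sum>l=1..N. (\<integral>x. f x * e l x \<partial>M) * (\<integral>x. h x * e l x \<partial>M)) \<longlonglongrightarrow> (\<integral>x. f x * h x \<partial>M)"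
proof -
  have "(\<lambda>N. \<integral>x. (\<Sum>l=1..N. (\<integral>y. f y * e l y \<partial>M) * e l x) * h x \<partial>M) \<longlonglongrightarrow> (\<integral>x. f x * h x \<partial>M)"
    by (rule L2_tendsto_inner[OF L2_combination assms expansion_tendsto[OF assms(1)]]) simp
  then show ?thesis using inner_sum[OF _ _ assms(2), of "{1.._}"] by simp
qed

end

subsection \<open>The weighted commutator inequality\<close>

text \<open>Averaging each double sum with its transpose, which the symmetry of \<open>w\<close>
  permits, turns the summands into the two sides of \<open>powr_diff_mult_diff_le\<close>.\<close>

lemma antisymmetrised_powr_sum_le:
  fixes y :: "'i \<Rightarrow> real" and w :: "'i \<Rightarrow> 'i \<Rightarrow> real"
  assumes "finite I" "\<And>i. i \<in> I \<Longrightarrow> 0 < y i"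
    and sym: "\<And>i l. i \<in> I \<Longrightarrow> l \<in> I \<Longrightarrow> w i l = w l i" and nonneg: "\<And>i l. 0 \<le> w i l"
  shows "(\<Sum>i\<in>I. \<Sum>l\<in>I. y i powr p * (y i - y l) * w i l)
    \<le> max 1 (p / 2) * (\<Sum>i\<in>I. \<Sum>l\<in>I. y i powr (p - 1) * (y i - y l)\<^sup>2 * w i l)"
    (is "?A \<le> ?C * ?B")
proof -
  have A: "?A = (\<Sum>i\<in>I. \<Sum>l\<in>I. y l powr p * (y l - y i) * w i l)"
    using sym by (subst sum.swap) (simp cong: sum.cong)
  have B: "?B = (\<Sum>i\<in>I. \<Sum>l\<in>I. y l powr (p - 1) * (y i - y l)\<^sup>2 * w i l)"
    using sym by (subst sum.swap) (simp add: power2_commute cong: sum.cong)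
  have "?A + ?A = (\<Sum>i\<in>I. \<Sum>l\<in>I. (y i powr p - y l powr p) * (y i - y l) * w i l)"
    by (subst (2) A) (simp add: algebra_simps flip: sum.distrib)
  also have "\<dots> \<le> (\<Sum>i\<in>I. \<Sum>l\<in>I. ?C * (y i powr (p - 1) + y l powr (p - 1)) * (y i - y l)\<^sup>2 * w i l)"
    using assms by (intro sum_mono mult_right_mono powr_diff_mult_diff_le) auto
  also have "\<dots> = ?C * ?B + ?C * ?B"
    by (subst (2) B) (simp add: algebra_simps sum_distrib_left flip: sum.distrib)
  finally show ?thesis by simp
qed

text \<open>Fix \<open>i\<close> with \<open>lam i < lam (k+1)\<close>. If
  \<open>lam l \<ge> lam (k+1)\<close>, then \<open>lam l - lam i\<close> is at least
  \<open>lam (k+1) - lam i\<close>, so one power of the weight can be traded for one more factor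
  \<open>lam l - lam i\<close>. For the remaining \<open>l\<close> the sign of
  \<open>lam l - lam i\<close> varies, and only the symmetry in \<open>i\<close> and
  \<open>l\<close> helps. \<open>Q i\<close> stands for the squared norm of
  \<open>X j u i\<close>.\<close>

lemma commutator_sum_inequality:
  fixes lam :: "nat \<Rightarrow> real" and a :: "nat \<Rightarrow> nat \<Rightarrow> real" and Q :: "nat \<Rightarrow> real"
  assumes mono: "\<And>i l. 1 \<le> i \<Longrightarrow> i \<le> l \<Longrightarrow> lam i \<le> lam l"
    and sym: "\<And>i l. a i l = a l i"
    and lim: "\<And>i. 1 \<le> i \<Longrightarrow> (\<lambda>N. \<Sum>l=1..N. (lam l - lam i) * (a i l)\<^sup>2) \<longlonglongrightarrow> 1"
    and bessel: "\<And>i N. 1 \<le> i \<Longrightarrow> (\<Sum>l=1..N. (lam l - lam i)\<^sup>2 * (a i l)\<^sup>2) \<le> 4 * Q i"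
  shows "(\<Sum>i=1..k. (lam (k+1) - lam i) powr p)
    \<le> max 4 (2 * p) * (\<Sum>i=1..k. (lam (k+1) - lam i) powr (p - 1) * Q i)"
proof -
  define y where "y i = lam (k+1) - lam i" for i
  define I where "I = {i\<in>{1..k}. 0 < y i}"
  define C where "C = max 1 (p / 2)"
  have C: "1 \<le> C" by (simp add: C_def)
  have I: "finite I" "\<And>i. i \<in> I \<Longrightarrow> 0 < y i" "\<And>i. i \<in> I \<Longrightarrow> 1 \<le> i" "I \<subseteq> {1..k}"
    by (auto simp: I_def)
  have y0: "y i = 0" if "i \<in> {1..k} - I" for i
    using that mono[of i "k+1"] by (auto simp: I_def y_def)
  have restrict: "(\<Sum>i=1..k. y i powr q * f i) = (\<Sum>i\<in>I. y i powr q * f i)" for q and f :: "nat \<Rightarrow> real"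
    by (rule sum.mono_neutral_right) (use I(4) y0 in auto)
  \<comment> \<open>The right-hand side is already free of \<open>N\<close>, since
    \<open>bessel\<close> bounds every partial sum; only the left-hand side has to pass to the
    limit.\<close>
  have fin: "(\<Sum>i\<in>I. y i powr p * (\<Sum>l=1..N. (lam l - lam i) * (a i l)\<^sup>2))
      \<le> (\<Sum>i\<in>I. y i powr (p - 1) * (4 * C * Q i))" if "k \<le> N" for N
  proof -
    define J where "J = {1..N} - I"
    have IJ: "{1..N} = I \<union> J" "I \<inter> J = {}" "finite J" using I(4) that by (auto simp: J_def)
    have split: "(\<Sum>l=1..N. f l) = (\<Sum>l\<in>I. f l) + (\<Sum>l\<in>J. f l)" for f :: "nat \<Rightarrow> real"
      unfolding IJ(1) using IJ I(1) by (intro sum.union_disjoint)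
    have J: "y i powr p * ((lam l - lam i) * (a i l)\<^sup>2) 
        \<le> C * (y i powr (p - 1) * ((lam l - lam i)\<^sup>2 * (a i l)\<^sup>2))" if "i \<in> I" "l \<in> J" for i l
    proof -
      have "lam (k+1) \<le> lam l"
      proof (cases "l \<le> k")
        case True
        then show ?thesis using that y0[of l] by (auto simp: J_def y_def)
      next
        case False
        then show ?thesis by (intro mono) auto
      qed
      then have yl: "y i \<le> lam l - lam i" by (simp add: y_def)
      have pos: "0 < y i" using I that by blast
      have "y i powr p = y i powr (p - 1) * y i"
        using pos powr_mult_base[of "y i" "p - 1"] by (simp add: mult.commute)
      also have "\<dots> \<le> y i powr (p - 1) * (lam l - lam i)" using yl by (intro mult_left_mono) auto
      finally have "y i powr p * ((lam l - lam i) * (a i l)\<^sup>2) 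
          \<le> y i powr (p - 1) * (lam l - lam i) * ((lam l - lam i) * (a i l)\<^sup>2)"
        using yl pos by (intro mult_right_mono) auto
      also have "\<dots> = 1 * (y i powr (p - 1) * ((lam l - lam i)\<^sup>2 * (a i l)\<^sup>2))"
        by (simp add: power2_eq_square)
      also have "\<dots> \<le> C * (y i powr (p - 1) * ((lam l - lam i)\<^sup>2 * (a i l)\<^sup>2))"
        using C by (intro mult_right_mono) auto
      finally show ?thesis .
    qed
    have diff: "lam l - lam i = y i - y l" for i l by (simp add: y_def)
    have "(\<Sum>i\<in>I. y i powr p * (\<Sum>l=1..N. (lam l - lam i) * (a i l)\<^sup>2))
        = (\<Sum>i\<in>I. \<Sum>l\<in>I. y i powr p * (y i - y l) * (a i l)\<^sup>2) 
          + (\<Sum>i\<in>I. \<Sum>l\<in>J. y i powr p * ((lam l - lam i) * (a i l)\<^sup>2))"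
      unfolding split by (simp add: sum_distrib_left distrib_left sum.distrib mult.assoc diff)
    also have "\<dots> \<le> C * (\<Sum>i\<in>I. \<Sum>l\<in>I. y i powr (p - 1) * (y i - y l)\<^sup>2 * (a i l)\<^sup>2)
          + (\<Sum>i\<in>I. \<Sum>l\<in>J. C * (y i powr (p - 1) * ((lam l - lam i)\<^sup>2 * (a i l)\<^sup>2)))"
      unfolding C_def
      by (intro add_mono antisymmetrised_powr_sum_le sum_mono J[unfolded C_def]) (use I sym in auto)
    also have "\<dots> = (\<Sum>i\<in>I. y i powr (p - 1) * (C * (\<Sum>l=1..N. (lam l - lam i)\<^sup>2 * (a i l)\<^sup>2)))"
      unfolding split 
      by (simp add: sum_distrib_left distrib_left sum.distrib mult_ac diff power2_commute)
    also have "\<dots> \<le> (\<Sum>i\<in>I. y i powr (p - 1) * (C * (4 * Q i)))"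
      using bessel I C by (intro sum_mono mult_left_mono) auto
    finally show ?thesis by (simp add: mult_ac)
  qed
  have "(\<lambda>N. \<Sum>i\<in>I. y i powr p * (\<Sum>l=1..N. (lam l - lam i) * (a i l)\<^sup>2)) \<longlonglongrightarrow> (\<Sum>i\<in>I. y i powr p * 1)"
    using I by (intro tendsto_intros lim) auto
  then have "(\<Sum>i\<in>I. y i powr p * 1) \<le> (\<Sum>i\<in>I. y i powr (p - 1) * (4 * C * Q i))"
    by (rule tendsto_upperbound) (use fin in \<open>auto simp: eventually_sequentially\<close>)
  also have "\<dots> = 4 * C * (\<Sum>i\<in>I. y i powr (p - 1) * Q i)"
    by (simp add: sum_distrib_left mult_ac)
  also have "4 * C = max 4 (2 * p)" by (simp add: C_def max_def)
  finally show ?thesis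
    using restrict[of p "\<lambda>_. 1"] restrict[of "p - 1" Q] unfolding y_def by simp
qed

subsection \<open>Smooth functions and symmetry of second derivatives\<close>

text \<open>The mean value theorem in direction \<open>h\<close> turns the second difference into a
  first difference of \<open>x \<mapsto> f' x h\<close>, evaluated at two points near
  \<open>a\<close> that differ by \<open>t *\<^sub>R k\<close>. The linear approximation at
  \<open>a\<close> is then applied at both points.\<close>

lemma second_difference_quotient_tendsto:
  fixes f :: "'a::real_normed_vector \<Rightarrow> real"
  assumes f: "\<And>x. (f has_derivative f' x) (at x)"
    and A: "((\<lambda>x. f' x h) has_derivative A) (at a)"
  shows "((\<lambda>t. (f (a + t *\<^sub>R h + t *\<^sub>R k) - f (a + t *\<^sub>R h) - f (a + t *\<^sub>R k) + f a) / t\<^sup>2) \<longlongrightarrow> A k)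
    (at_right 0)"
proof (rule tendstoI)
  fix e :: real assume e: "0 < e"
  interpret A: bounded_linear A using A by (rule has_derivative_bounded_linear)
  \<comment> \<open>\<open>t * c\<close> bounds the sum of the distances of the two points from
    \<open>a\<close>; the summand 1 keeps \<open>c\<close> positive when \<open>h\<close> and
    \<open>k\<close> vanish.\<close>
  define c where "c = 2 * norm h + norm k + 1"
  have c: "0 < c" by (simp add: c_def add_nonneg_pos)
  have "0 < e / (2 * c)" using e c by simp
  then obtain \<delta> where \<delta>: "0 < \<delta>" and
    R: "\<And>y. norm (y - a) < \<delta> \<Longrightarrow> norm (f' y h - f' a h - A (y - a)) \<le> e / (2 * c) * norm (y - a)"
    using A unfolding has_derivative_at_alt by blast
  have bound: "dist ((f (a + t *\<^sub>R h + t *\<^sub>R k) - f (a + t *\<^sub>R h) - f (a + t *\<^sub>R k) + f a) / t\<^sup>2) (A k) < e"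
    if t: "0 < t" "t < \<delta> / c" for t
  proof -
    let ?\<phi> = "\<lambda>s. f (a + s *\<^sub>R h + t *\<^sub>R k) - f (a + s *\<^sub>R h)"
    have der: "(?\<phi> has_real_derivative f' (a + s *\<^sub>R h + t *\<^sub>R k) h - f' (a + s *\<^sub>R h) h) (at s)" for s
    proof -
      have 1: "((\<lambda>s. f (b + s *\<^sub>R h)) has_real_derivative f' (b + s *\<^sub>R h) h) (at s)" for b s
      proof -
        have "((\<lambda>s. b + s *\<^sub>R h) has_derivative (\<lambda>s. s *\<^sub>R h)) (at s)"
          by (auto intro!: derivative_eq_intros)
        from has_derivative_compose[OF this f] 
        have "((\<lambda>s. f (b + s *\<^sub>R h)) has_derivative (\<lambda>s'. f' (b + s *\<^sub>R h) (s' *\<^sub>R h))) (at s)" .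
        then show ?thesis
          using linear_cmul[OF has_derivative_linear[OF f]]
          by (simp add: has_field_derivative_def mult_commute_abs)
      qed
      show ?thesis using 1[of "a + t *\<^sub>R k"] 1[of a] by (auto intro!: derivative_eq_intros simp: add_ac)
    qed
    have "\<exists>s. 0 < s \<and> s < t \<and> ?\<phi> t - ?\<phi> 0 = (t - 0) * (f' (a + s *\<^sub>R h + t *\<^sub>R k) h - f' (a + s *\<^sub>R h) h)"
      by (rule MVT2[OF t(1)]) (rule der)
    then obtain s where s: "0 < s" "s < t" and
      eq: "?\<phi> t - ?\<phi> 0 = t * (f' (a + s *\<^sub>R h + t *\<^sub>R k) h - f' (a + s *\<^sub>R h) h)" by auto
    let ?u = "s *\<^sub>R h + t *\<^sub>R k" and ?v = "s *\<^sub>R h"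
    have nv: "norm ?v \<le> t * norm h" using s by (simp add: mult_right_mono)
    have nu: "norm ?u \<le> t * norm h + t * norm k"
      using norm_triangle_ineq[of ?v "t *\<^sub>R k"] nv t by simp
    have "t * c < \<delta>" using t c by (simp add: field_simps)
    moreover have "t * c = t * norm h + t * norm h + t * norm k + t" by (simp add: c_def algebra_simps)
    moreover have "0 \<le> t * norm h" "0 \<le> t * norm k" using t by simp_all
    ultimately have lt: "norm ?u < \<delta>" "norm ?v < \<delta>" 
      using nu nv t by linarith+
    \<comment> \<open>Since \<open>?u - ?v = t *\<^sub>R k\<close>, the linear parts combine to
      \<open>t * A k\<close> and only the two remainders are left.\<close>
    have "\<bar>f' (a + ?u) h - f' (a + ?v) h - t * A k\<bar> 
        = \<bar>(f' (a + ?u) h - f' a h - A ?u) - (f' (a + ?v) h - f' a h - A ?v)\<bar>"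
      by (simp add: A.add A.scaleR)
    also have "\<dots> \<le> e / (2 * c) * norm ?u + e / (2 * c) * norm ?v"
      using R[of "a + ?u"] R[of "a + ?v"] lt by (simp add: abs_le_iff)
    also have "\<dots> = e / (2 * c) * (norm ?u + norm ?v)" by (simp add: distrib_left)
    also have "\<dots> \<le> e / (2 * c) * (t * c)"
      using nu nv e c t by (intro mult_left_mono) (auto simp: c_def algebra_simps)
    also have "\<dots> = t * (e / 2)" using c by simp
    finally have "\<bar>f' (a + ?u) h - f' (a + ?v) h - t * A k\<bar> \<le> t * (e / 2)" .
    then have "\<bar>(f' (a + ?u) h - f' (a + ?v) h) / t - A k\<bar> \<le> e / 2"
      using t by (simp add: abs_le_iff field_simps)
    moreover have "(f (a + t *\<^sub>R h + t *\<^sub>R k) - f (a + t *\<^sub>R h) - f (a + t *\<^sub>R k) + f a) / t\<^sup>2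
        = (f' (a + ?u) h - f' (a + ?v) h) / t"
    proof -
      have "f (a + t *\<^sub>R h + t *\<^sub>R k) - f (a + t *\<^sub>R h) - f (a + t *\<^sub>R k) + f a
          = t * (f' (a + ?u) h - f' (a + ?v) h)" using eq by (simp add: add.assoc)
      then show ?thesis using t by (simp only:) (simp add: power2_eq_square)
    qed
    ultimately show ?thesis using e by (simp add: dist_real_def)
  qed
  show "\<forall>\<^sub>F t in at_right 0. dist ((f (a + t *\<^sub>R h + t *\<^sub>R k) - f (a + t *\<^sub>R h) - f (a + t *\<^sub>R k) + f a) / t\<^sup>2) (A k) < e"
    using bound \<delta> c by (auto simp: eventually_at_right_field intro!: exI[of _ "\<delta> / c"])
qed

text \<open>The second difference is unchanged when \<open>h\<close> and \<open>k\<close> are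
  exchanged, so its two limits coincide (Young's theorem).\<close>

lemma second_derivative_symmetric:
  fixes f :: "'a::real_normed_vector \<Rightarrow> real"
  assumes f: "\<And>x. (f has_derivative f' x) (at x)"
    and A: "((\<lambda>x. f' x h) has_derivative A) (at a)"
    and B: "((\<lambda>x. f' x k) has_derivative B) (at a)"
  shows "A k = B h"
proof (rule tendsto_unique)
  show "((\<lambda>t. (f (a + t *\<^sub>R h + t *\<^sub>R k) - f (a + t *\<^sub>R h) - f (a + t *\<^sub>R k) + f a) / t\<^sup>2) \<longlongrightarrow> A k)
    (at_right 0)"
    by (rule second_difference_quotient_tendsto[OF f A])
  show "((\<lambda>t. (f (a + t *\<^sub>R h + t *\<^sub>R k) - f (a + t *\<^sub>R h) - f (a + t *\<^sub>R k) + f a) / t\<^sup>2) \<longlongrightarrow> B h)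
    (at_right 0)"
    using second_difference_quotient_tendsto[OF f B, of h]
    by (rule Lim_transform_eventually) (simp add: algebra_simps)
qed simp

lemma smooth_on_imp_differentiable:
  assumes "smooth_on S f" "x \<in> S"
  shows "f differentiable (at x)"
  using assms unfolding smooth_on_def by (auto dest: spec[of _ "[]"])

text \<open>\<open>smooth_on\<close> speaks of directions in \<open>Basis\<close> only; linearity of
  the derivative extends this to any \<open>h\<close>.\<close>

lemma smooth_on_frechet_derivative_differentiable:
  fixes f :: "'a::euclidean_space \<Rightarrow> real"
  assumes "smooth_on UNIV f"
  shows "(\<lambda>x. frechet_derivative f (at x) h) differentiable (at x)"
proof -
  have "frechet_derivative f (at x) h = (\<Sum>e\<in>Basis. (h \<bullet> e) * pd [e] f x)" for x
  proof -
    have lin: "linear (frechet_derivative f (at x))"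
      using smooth_on_imp_differentiable[OF assms] by (simp add: linear_frechet_derivative)
    have "frechet_derivative f (at x) (\<Sum>e\<in>Basis. (h \<bullet> e) *\<^sub>R e) = (\<Sum>e\<in>Basis. (h \<bullet> e) * pd [e] f x)"
      by (simp add: linear_sum[OF lin] linear_cmul[OF lin])
    then show ?thesis by (simp add: euclidean_representation)
  qed
  moreover have "pd [e] f differentiable (at x)" if "e \<in> Basis" for e
    using assms that unfolding smooth_on_def by (auto simp del: pd.simps)
  ultimately show ?thesis
    by (simp del: pd.simps)
qed

text \<open>The factor \<open>b \<bullet> x\<close> is linear, so at most one derivative falls on
  it, and every further term is a constant times a derivative of \<open>\<phi>\<close>. Recording
  these terms as an unspecified list of pairs gives a shape that is closed under one more
  differentiation.\<close>

lemma pd_inner_mult: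
  fixes \<phi> :: "'a::euclidean_space \<Rightarrow> real"
  assumes "smooth_on UNIV \<phi>" "set es \<subseteq> Basis"
  shows "\<exists>cs. (\<forall>(c, fs)\<in>set cs. set fs \<subseteq> Basis) \<and>
    pd es (\<lambda>x. (b \<bullet> x) * \<phi> x) = (\<lambda>x. (b \<bullet> x) * pd es \<phi> x + (\<Sum>(c, fs)\<leftarrow>cs. c * pd fs \<phi> x))"
  using assms(2)
proof (induction es)
  case Nil
  then show ?case by (intro exI[of _ "[]"]) simp
next
  case (Cons e es)
  then obtain cs :: "(real \<times> 'a list) list" where cs: "\<forall>(c, fs)\<in>set cs. set fs \<subseteq> Basis"
    and eq: "pd es (\<lambda>x. (b \<bullet> x) * \<phi> x) = (\<lambda>x. (b \<bullet> x) * pd es \<phi> x + (\<Sum>(c, fs)\<leftarrow>cs. c * pd fs \<phi> x))"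
    by auto
  have der: "(pd fs \<phi> has_derivative frechet_derivative (pd fs \<phi>) (at x)) (at x)" if "set fs \<subseteq> Basis" for fs x
    using assms(1) that by (simp add: smooth_on_def flip: frechet_derivative_works)
  have sum: "((\<lambda>x. \<Sum>(c, fs)\<leftarrow>cs. c * pd fs \<phi> x) has_derivative
      (\<lambda>h. \<Sum>(c, fs)\<leftarrow>cs. c * frechet_derivative (pd fs \<phi>) (at x) h)) (at x)" for x
    using cs by (induction cs) (auto intro!: derivative_eq_intros der)
  have "pd (e # es) (\<lambda>x. (b \<bullet> x) * \<phi> x) x = 
     (b \<bullet> x) * pd (e # es) \<phi> x + (b \<bullet> e) * pd es \<phi> x + (\<Sum>(c, fs)\<leftarrow>cs. c * pd (e # fs) \<phi> x)" for x
  proof -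
    have "((\<lambda>x. (b \<bullet> x) * pd es \<phi> x + (\<Sum>(c, fs)\<leftarrow>cs. c * pd fs \<phi> x)) has_derivative
        (\<lambda>h. (b \<bullet> x) * frechet_derivative (pd es \<phi>) (at x) h + (b \<bullet> h) * pd es \<phi> x 
           + (\<Sum>(c, fs)\<leftarrow>cs. c * frechet_derivative (pd fs \<phi>) (at x) h))) (at x)"
      using Cons.prems by (auto intro!: derivative_eq_intros der sum)
    from frechet_derivative_at[OF this] show ?thesis by (simp add: eq fun_eq_iff)
  qed
  moreover have "(\<Sum>(c, fs)\<leftarrow>map (\<lambda>(c, fs). (c, e # fs)) cs. c * pd fs \<phi> x) = (\<Sum>(c, fs)\<leftarrow>cs. c * pd (e # fs) \<phi> x)" for x
    by (simp add: o_def split_def)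
  moreover have "set fs \<subseteq> Basis" if "(c, fs) \<in> set cs" for c fs
    using cs that by auto
  \<comment> \<open>The new pair comes from differentiating \<open>b \<bullet> x\<close>; in the old
    pairs \<open>e\<close> is put in front of the list of directions.\<close>
  ultimately show ?case using Cons.prems
    by (intro exI[of _ "(b \<bullet> e, es) # map (\<lambda>(c, fs). (c, e # fs)) cs"]) (force simp: fun_eq_iff)
qed

lemma smooth_on_inner_mult:
  fixes \<phi> :: "'a::euclidean_space \<Rightarrow> real"
  assumes "smooth_on UNIV \<phi>"
  shows "smooth_on UNIV (\<lambda>x. (b \<bullet> x) * \<phi> x)"
  unfolding smooth_on_def
proof (intro allI impI ballI)
  fix es :: "'a list" and x assume es: "set es \<subseteq> Basis"
  from pd_inner_mult[OF assms es, of b] obtain cs :: "(real \<times> 'a list) list" where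
    cs: "\<forall>(c, fs)\<in>set cs. set fs \<subseteq> Basis"
    and eq: "pd es (\<lambda>x. (b \<bullet> x) * \<phi> x) = (\<lambda>x. (b \<bullet> x) * pd es \<phi> x + (\<Sum>(c, fs)\<leftarrow>cs. c * pd fs \<phi> x))"
    by blast
  have d: "pd fs \<phi> differentiable (at x)" if "set fs \<subseteq> Basis" for fs
    using assms that by (simp add: smooth_on_def)
  have "(\<lambda>x. \<Sum>(c, fs)\<leftarrow>cs. c * pd fs \<phi> x) differentiable (at x)"
    using cs by (induction cs) (auto intro!: differentiable_add differentiable_mult d)
  moreover have "(\<lambda>x. b \<bullet> x) differentiable (at x)"
    by (simp add: bounded_linear_imp_differentiable bounded_linear_inner_right)
  ultimately show "pd es (\<lambda>x. (b \<bullet> x) * \<phi> x) differentiable (at x)"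
    unfolding eq using d[OF es] by (intro differentiable_add differentiable_mult)
qed

subsection \<open>Horizontal coordinates on a Carnot group\<close>

locale carnot =
  fixes gm :: "real^'n \<Rightarrow> real^'n \<Rightarrow> real^'n" and V :: "nat \<Rightarrow> (real^'n) set" and r :: nat
  assumes carnot: "carnot_group gm V r"
begin

lemma assoc: "gm (gm x y) z = gm x (gm y z)"
  and left_zero: "gm 0 x = x" and right_zero: "gm x 0 = x"
  and one_param: "gm (s *\<^sub>R v) (t *\<^sub>R v) = (s + t) *\<^sub>R v"
  and smooth: "smooth_on UNIV (\<lambda>p. gm (fst p) (snd p) $ k)"
  and span_V: "span (\<Union>j\<in>{1..r}. V j) = UNIV"
  using carnot unfolding carnot_group_def by (elim conjE; simp)+

lemma orth: "i \<noteq> j \<Longrightarrow> x \<in> V i \<Longrightarrow> y \<in> V j \<Longrightarrow> x \<bullet> y = 0"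
proof -
  have "\<forall>i j. i \<noteq> j \<longrightarrow> (\<forall>x\<in>V i. \<forall>y\<in>V j. x \<bullet> y = 0)"
    using carnot unfolding carnot_group_def by (elim conjE)
  then show "i \<noteq> j \<Longrightarrow> x \<in> V i \<Longrightarrow> y \<in> V j \<Longrightarrow> x \<bullet> y = 0" by blast
qed

lemma br_V: "v \<in> V i \<Longrightarrow> w \<in> V j \<Longrightarrow> lie_br gm v w \<in> V (i + j)"
proof -
  have "\<forall>i j. {lie_br gm v w | v w. v \<in> V i \<and> w \<in> V j} \<subseteq> V (i + j)"
    using carnot unfolding carnot_group_def by (elim conjE)
  then show "v \<in> V i \<Longrightarrow> w \<in> V j \<Longrightarrow> lie_br gm v w \<in> V (i + j)" by blast
qed

lemma V_Suc: "1 \<le> j \<Longrightarrow> j < r \<Longrightarrow> V (Suc j) = span {lie_br gm v w | v w. v \<in> V 1 \<and> w \<in> V j}"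
proof -
  have "\<forall>j. 1 \<le> j \<and> j < r \<longrightarrow> span {lie_br gm v w | v w. v \<in> V 1 \<and> w \<in> V j} = V (Suc j)"
    using carnot unfolding carnot_group_def by (elim conjE)
  then show "1 \<le> j \<Longrightarrow> j < r \<Longrightarrow> V (Suc j) = span {lie_br gm v w | v w. v \<in> V 1 \<and> w \<in> V j}" by simp
qed

lemma neg_left: "gm (- x) x = 0"
  using one_param[of "-1" x 1] by simp

text \<open>The differential of multiplication. \<open>D (x, 0) (0, v)\<close> is the value at
  \<open>x\<close> of the left-invariant field of \<open>v\<close>, and \<open>D p (0, z)\<close> is
  the differential of left translation by \<open>fst p\<close> at \<open>snd p\<close>, applied to
  \<open>z\<close>.\<close>

definition D :: "(real^'n) \<times> (real^'n) \<Rightarrow> (real^'n) \<times> (real^'n) \<Rightarrow> real^'n" where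
  "D p = frechet_derivative (\<lambda>p. gm (fst p) (snd p)) (at p)"

lemma D: "((\<lambda>p. gm (fst p) (snd p)) has_derivative D p) (at p)"
proof -
  have "(\<lambda>p. gm (fst p) (snd p)) differentiable (at p)"
    using smooth_on_imp_differentiable[OF smooth]
    by (subst differentiable_componentwise_within) (auto simp: Basis_vec_def inner_axis)
  then show ?thesis unfolding D_def frechet_derivative_works .
qed

lemma linear_D: "linear (D p)"
  using D by (rule has_derivative_linear)

lemma D_component: "D p h $ k = frechet_derivative (\<lambda>p. gm (fst p) (snd p) $ k) (at p) h"
proof -
  have "((\<lambda>p. gm (fst p) (snd p) $ k) has_derivative (\<lambda>h. D p h $ k)) (at p)"
    by (rule bounded_linear.has_derivative[OF bounded_linear_vec_nth D])
  from frechet_derivative_at[OF this] show ?thesis by metis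
qed

lemma D_differentiable: "(\<lambda>p. D p h) differentiable (at p)"
proof -
  have "(\<lambda>p. D p h $ k) differentiable (at p)" for k
    unfolding D_component by (rule smooth_on_frechet_derivative_differentiable[OF smooth])
  then show ?thesis
    by (subst differentiable_componentwise_within) (auto simp: Basis_vec_def inner_axis)
qed

definition D2 :: "(real^'n) \<times> (real^'n) \<Rightarrow> (real^'n) \<times> (real^'n) \<Rightarrow> (real^'n) \<times> (real^'n) \<Rightarrow> real^'n" where
  "D2 p h = frechet_derivative (\<lambda>p. D p h) (at p)"

lemma D2: "((\<lambda>p. D p h) has_derivative D2 p h) (at p)"
  using D_differentiable unfolding D2_def frechet_derivative_works .

lemma linear_D2: "linear (D2 p h)"
  using D2 by (rule has_derivative_linear)

lemma D2_sym: "D2 p h k = D2 p k h"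
proof -
  have "((\<lambda>p. gm (fst p) (snd p) $ i) has_derivative (\<lambda>h. D p h $ i)) (at p)" for p i
    by (rule bounded_linear.has_derivative[OF bounded_linear_vec_nth D])
  moreover have "((\<lambda>p. D p h $ i) has_derivative (\<lambda>k. D2 p h k $ i)) (at p)" for h i
    by (rule bounded_linear.has_derivative[OF bounded_linear_vec_nth D2])
  ultimately have "D2 p h k $ i = D2 p k h $ i" for i
    using second_derivative_symmetric[where f' = "\<lambda>p h. D p h $ i" and A = "\<lambda>k. D2 p h k $ i" and B = "\<lambda>h. D2 p k h $ i"]
    by blast
  then show ?thesis by (simp add: vec_eq_iff)
qed

lemma curve_deriv:
  assumes "(c has_vector_derivative c') (at t)" "(e has_vector_derivative e') (at t)"
  shows "((\<lambda>t. gm (c t) (e t)) has_vector_derivative D (c t, e t) (c', e')) (at t)"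
proof -
  have "((\<lambda>t. (c t, e t)) has_derivative (\<lambda>s. (s *\<^sub>R c', s *\<^sub>R e'))) (at t)"
    using assms unfolding has_vector_derivative_def by (rule has_derivative_Pair)
  from has_derivative_compose[OF this D] 
  show ?thesis
    using linear_cmul[OF linear_D, of "(c t, e t)" _ "(c', e')"] by (simp add: has_vector_derivative_def)
qed

lemma curve_deriv2:
  assumes "(c has_vector_derivative c') (at t)" "(e has_vector_derivative e') (at t)"
  shows "((\<lambda>t. D (c t, e t) h) has_vector_derivative D2 (c t, e t) h (c', e')) (at t)"
proof -
  have "((\<lambda>t. (c t, e t)) has_derivative (\<lambda>s. (s *\<^sub>R c', s *\<^sub>R e'))) (at t)"
    using assms unfolding has_vector_derivative_def by (rule has_derivative_Pair)
  from has_derivative_compose[OF this D2[of h]] 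
  show ?thesis
    using linear_cmul[OF linear_D2, of "(c t, e t)" h _ "(c', e')"] by (simp add: has_vector_derivative_def)
qed

lemma ray_deriv: "((\<lambda>t. t *\<^sub>R v) has_vector_derivative v) (at t)"
  by (auto intro!: derivative_eq_intros)

lemma D_zero_left: "D (0, y) (0, k) = k"
proof -
  have "((\<lambda>t. gm 0 (y + t *\<^sub>R k)) has_vector_derivative D (0, y + 0 *\<^sub>R k) (0, k)) (at 0)"
    by (rule curve_deriv) (auto intro!: derivative_eq_intros)
  moreover have "((\<lambda>t. gm 0 (y + t *\<^sub>R k)) has_vector_derivative k) (at 0)"
    unfolding left_zero by (auto intro!: derivative_eq_intros)
  ultimately show ?thesis using vector_derivative_unique_at by fastforce
qed

lemma D_zero_right: "D (x, 0) (h, 0) = h"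
proof -
  have "((\<lambda>t. gm (x + t *\<^sub>R h) 0) has_vector_derivative D (x + 0 *\<^sub>R h, 0) (h, 0)) (at 0)"
    by (rule curve_deriv) (auto intro!: derivative_eq_intros)
  moreover have "((\<lambda>t. gm (x + t *\<^sub>R h) 0) has_vector_derivative h) (at 0)"
    unfolding right_zero by (auto intro!: derivative_eq_intros)
  ultimately show ?thesis using vector_derivative_unique_at by fastforce
qed

lemma D2_right_right: "D2 (0, 0) (0, z) (0, w) = 0"
proof -
  have "((\<lambda>t. D (0, t *\<^sub>R w) (0, z)) has_vector_derivative D2 (0, 0 *\<^sub>R w) (0, z) (0, w)) (at 0)"
    by (rule curve_deriv2) (auto intro!: derivative_eq_intros)
  moreover have "((\<lambda>t. D (0, t *\<^sub>R w) (0, z)) has_vector_derivative 0) (at 0)"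
    unfolding D_zero_left by simp
  ultimately show ?thesis using vector_derivative_unique_at by fastforce
qed

text \<open>The mixed second derivative of multiplication at the identity. Its antisymmetric part is
  the Lie bracket.\<close>

definition mixed :: "real^'n \<Rightarrow> real^'n \<Rightarrow> real^'n" where
  "mixed y w = D2 (0, 0) (0, w) (y, 0)"

lemma linear_mixed_left: "linear (\<lambda>y. mixed y w)"
proof -
  have "linear (\<lambda>y. (y, 0) :: (real^'n) \<times> (real^'n))" by (rule linearI) auto
  from linear_compose[OF this linear_D2] show ?thesis by (simp add: mixed_def o_def)
qed

lemma linear_mixed_right: "linear (mixed y)"
proof -
  have "linear (\<lambda>w. (0, w) :: (real^'n) \<times> (real^'n))" by (rule linearI) auto
  from linear_compose[OF this linear_D2[of "(0, 0)" "(y, 0)"]] 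
  have "linear (\<lambda>w. D2 (0, 0) (y, 0) (0, w))" by (simp add: o_def)
  also have "(\<lambda>w. D2 (0, 0) (y, 0) (0, w)) = mixed y"
    unfolding mixed_def by (rule ext) (rule D2_sym)
  finally show ?thesis .
qed

lemma lvf_eq:
  assumes "(f has_derivative f') (at x)"
  shows "lvf gm v f x = f' (D (x, 0) (0, v))"
proof -
  have "((\<lambda>t. gm x (t *\<^sub>R v)) has_vector_derivative D (x, 0 *\<^sub>R v) (0, v)) (at 0)"
    by (rule curve_deriv) (auto intro!: derivative_eq_intros)
  then have c: "((\<lambda>t. gm x (t *\<^sub>R v)) has_derivative (\<lambda>s. s *\<^sub>R D (x, 0) (0, v))) (at 0)"
    by (simp add: has_vector_derivative_def)
  have "(f has_derivative f') (at (gm x (0 *\<^sub>R v)))" using assms by (simp add: right_zero)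
  from has_derivative_compose[OF c this]
  have "((\<lambda>t. f (gm x (t *\<^sub>R v))) has_derivative (\<lambda>s. f' (s *\<^sub>R D (x, 0) (0, v)))) (at 0)" .
  then have "((\<lambda>t. f (gm x (t *\<^sub>R v))) has_real_derivative f' (D (x, 0) (0, v))) (at 0)"
    using linear_cmul[OF has_derivative_linear[OF assms]]
    by (simp add: has_field_derivative_def mult_commute_abs)
  then show ?thesis unfolding lvf_def by (rule DERIV_imp_deriv)
qed

lemma lvf_coord: "lvf gm v (\<lambda>y. y $ k) = (\<lambda>x. D (x, 0) (0, v) $ k)"
  by (rule ext, rule lvf_eq, rule bounded_linear.has_derivative[OF bounded_linear_vec_nth has_derivative_ident])

lemma lvf_lvf_coord: "lvf gm v (lvf gm w (\<lambda>y. y $ k)) 0 = mixed v w $ k"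
proof -
  have "((\<lambda>x. (x, 0)) has_derivative (\<lambda>h. (h, 0))) (at (0::real^'n))"
    by (auto intro!: derivative_eq_intros)
  from has_derivative_compose[OF this D2[of "(0, w)"]]
  have "((\<lambda>x. D (x, 0) (0, w)) has_derivative (\<lambda>h. D2 (0, 0) (0, w) (h, 0))) (at 0)" by simp
  from bounded_linear.has_derivative[OF bounded_linear_vec_nth this, of k]
  have "((\<lambda>x. D (x, 0) (0, w) $ k) has_derivative (\<lambda>h. mixed h w $ k)) (at 0)" by (simp add: mixed_def)
  from lvf_eq[OF this, of v] show ?thesis by (simp add: lvf_coord D_zero_left)
qed

lemma lie_br_eq: "lie_br gm v w = mixed v w - mixed w v"
  unfolding lie_br_def lvf_lvf_coord by (simp add: vec_eq_iff)

text \<open>A bracket of vectors from layers i, j \<ge> 1 lies in layer i + j \<ge> 2, which is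
  orthogonal to the first. Bilinearity, visible once the bracket is written with
  \<open>mixed\<close>, extends this to the span of the layers, which is everything.\<close>

lemma inner_lie_br:
  assumes b: "b \<in> V 1"
  shows "b \<bullet> lie_br gm y w = 0"
proof -
  have lin1: "linear (\<lambda>y. b \<bullet> lie_br gm y w)" for w
    unfolding lie_br_eq
    by (intro linearI) (simp_all add: linear_add[OF linear_mixed_left] linear_add[OF linear_mixed_right]
      linear_cmul[OF linear_mixed_left] linear_cmul[OF linear_mixed_right] inner_simps algebra_simps)
  have lin2: "linear (\<lambda>w. b \<bullet> lie_br gm y w)" for y
    unfolding lie_br_eq
    by (intro linearI) (simp_all add: linear_add[OF linear_mixed_left] linear_add[OF linear_mixed_right]
      linear_cmul[OF linear_mixed_left] linear_cmul[OF linear_mixed_right] inner_simps algebra_simps)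
  have 1: "b \<bullet> lie_br gm v u = 0" if "v \<in> (\<Union>j\<in>{1..r}. V j)" "u \<in> (\<Union>j\<in>{1..r}. V j)" for v u
  proof -
    obtain i j where "v \<in> V i" "u \<in> V j" "1 \<le> i" "1 \<le> j" using \<open>v \<in> _\<close> \<open>u \<in> _\<close> by auto
    then show ?thesis using br_V[of v i u j] b by (intro orth[of 1 "i + j"]) auto
  qed
  have 2: "b \<bullet> lie_br gm v w = 0" if "v \<in> (\<Union>j\<in>{1..r}. V j)" for v
    using linear_eq_0_on_span[where f = "\<lambda>w. b \<bullet> lie_br gm v w", OF lin2 1[OF that]] span_V by blast
  show ?thesis
    using linear_eq_0_on_span[where f = "\<lambda>y. b \<bullet> lie_br gm y w", OF lin1 2] span_V by blast
qed

text \<open>The differential of the exponential map at \<open>t w\<close> in direction \<open>t v\<close>, moved back to the identity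
by left translation; it solves \<open>y' = v + [y, w]\<close>,
and pairing with a vector of the first layer kills the bracket.\<close>

definition ltriv :: "real^'n \<Rightarrow> real^'n \<Rightarrow> real \<Rightarrow> real^'n" where
  "ltriv w v t = D (- (t *\<^sub>R w), t *\<^sub>R w) (0, t *\<^sub>R v)"

text \<open>\<open>ltriv w v t\<close> is the \<open>s\<close>-derivative at 0 of
  \<open>P t s\<close>, the product of \<open>- (t *\<^sub>R w)\<close> and
  \<open>t *\<^sub>R (w + s *\<^sub>R v)\<close>. Splitting both factors by the one-parameter
  property expresses \<open>P (t + h)\<close> through \<open>P t\<close>, which moves the derivative
  at any \<open>t\<close> to \<open>h = 0\<close>, near the identity.\<close>

lemma ltriv_add:
  "ltriv w v (t + h) = D (- (h *\<^sub>R w), h *\<^sub>R w) (0, D (0, h *\<^sub>R w) (ltriv w v t, h *\<^sub>R v))"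
proof -
  define P where "P t s = gm (- (t *\<^sub>R w)) (t *\<^sub>R (w + s *\<^sub>R v))" for t s
  have P0: "P t 0 = 0" for t by (simp add: P_def neg_left)
  have line: "((\<lambda>s. t *\<^sub>R (w + s *\<^sub>R v)) has_vector_derivative t *\<^sub>R v) (at 0)" for t
    by (auto intro!: derivative_eq_intros)
  have P': "(P t has_vector_derivative ltriv w v t) (at 0)" for t
    using curve_deriv[OF has_vector_derivative_const line, of "- (t *\<^sub>R w)" t]
    by (simp add: P_def[abs_def] ltriv_def)
  have eq: "P (t + h) s = gm (- (h *\<^sub>R w)) (gm (P t s) (h *\<^sub>R (w + s *\<^sub>R v)))" for s
  proof -
    have "- ((t + h) *\<^sub>R w) = gm (- (h *\<^sub>R w)) (- (t *\<^sub>R w))"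
      using one_param[of "-h" w "-t"] by (simp add: algebra_simps)
    moreover have "(t + h) *\<^sub>R (w + s *\<^sub>R v) = gm (t *\<^sub>R (w + s *\<^sub>R v)) (h *\<^sub>R (w + s *\<^sub>R v))"
      by (rule one_param[symmetric])
    ultimately show ?thesis by (simp only: P_def assoc)
  qed
  have "(P (t + h) has_vector_derivative
      D (- (h *\<^sub>R w), gm (P t 0) (h *\<^sub>R (w + 0 *\<^sub>R v))) (0, D (P t 0, h *\<^sub>R (w + 0 *\<^sub>R v)) (ltriv w v t, h *\<^sub>R v))) (at 0)"
    unfolding eq by (intro curve_deriv P' line has_vector_derivative_const)
  then show ?thesis
    using vector_derivative_unique_at[OF P'] by (simp add: P0 left_zero)
qed

text \<open>At \<open>h = 0\<close> the inner factor in \<open>ltriv_add\<close> contributes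
  \<open>v + mixed y w\<close>, where \<open>y\<close> is \<open>ltriv w v t\<close>. The outer
  translation contributes \<open>- mixed w y\<close>, because the second derivative purely in the
  right variable vanishes at the identity. Together these are \<open>v\<close> plus the
  bracket.\<close>

lemma ltriv_deriv: "(ltriv w v has_vector_derivative v + lie_br gm (ltriv w v t) w) (at t)"
proof -
  let ?y = "ltriv w v t"
  define q where "q h = D (0, h *\<^sub>R w) (?y, 0) + h *\<^sub>R v" for h
  have q: "D (0, h *\<^sub>R w) (?y, h *\<^sub>R v) = q h" for h
    using linear_add[OF linear_D, of "(0, h *\<^sub>R w)" "(?y, 0)" "(0, h *\<^sub>R v)"] by (simp add: q_def D_zero_left)
  have q0: "q 0 = ?y" by (simp add: q_def D_zero_right)
  have "((\<lambda>h. D (0, h *\<^sub>R w) (?y, 0)) has_vector_derivative D2 (0, 0 *\<^sub>R w) (?y, 0) (0, w)) (at 0)"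
    by (rule curve_deriv2) (auto intro!: derivative_eq_intros)
  then have q': "(q has_vector_derivative mixed ?y w + v) (at 0)"
    unfolding q_def[abs_def]
    by (intro has_vector_derivative_add ray_deriv) (simp add: mixed_def D2_sym[of _ "(?y, 0)"])
  \<comment> \<open>A varying linear map is applied to a varying vector; expanding the vector in
    \<open>Basis\<close> makes the product rule applicable.\<close>
  have expand: "D p (0, z) = (\<Sum>e\<in>Basis. (z \<bullet> e) *\<^sub>R D p (0, e))" for p z
  proof -
    have "linear (\<lambda>w. (0, w) :: (real^'n) \<times> (real^'n))" by (rule linearI) auto
    from linear_compose[OF this linear_D[of p]] have lin: "linear (\<lambda>w. D p (0, w))" by (simp add: o_def)
    have "D p (0, \<Sum>e\<in>Basis. (z \<bullet> e) *\<^sub>R e) = (\<Sum>e\<in>Basis. (z \<bullet> e) *\<^sub>R D p (0, e))"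
      by (simp add: linear_sum[OF lin] linear_cmul[OF lin])
    then show ?thesis by (simp add: euclidean_representation)
  qed
  have De: "((\<lambda>h. D (- (h *\<^sub>R w), h *\<^sub>R w) (0, e)) has_vector_derivative - mixed w e) (at 0)" for e
  proof -
    have "((\<lambda>h. D (- (h *\<^sub>R w), h *\<^sub>R w) (0, e)) has_vector_derivative
        D2 (- (0 *\<^sub>R w), 0 *\<^sub>R w) (0, e) (- w, w)) (at 0)"
      by (rule curve_deriv2) (auto intro!: derivative_eq_intros)
    moreover have "D2 (0, 0) (0, e) (- w, w) = - mixed w e"
      using linear_add[OF linear_D2, of "(0, 0)" "(0, e)" "(- w, 0)" "(0, w)"] D2_right_right[of e w]
        linear_neg[OF linear_D2, of "(0, 0)" "(0, e)" "(w, 0)"] by (simp add: mixed_def)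
    ultimately show ?thesis by simp
  qed
  have qe: "((\<lambda>h. q h \<bullet> e) has_real_derivative (mixed ?y w + v) \<bullet> e) (at 0)" for e
    using bounded_linear.has_vector_derivative[OF bounded_linear_inner_left q']
    by (simp add: has_real_derivative_iff_has_vector_derivative)
  have "((\<lambda>h. \<Sum>e\<in>Basis. (q h \<bullet> e) *\<^sub>R D (- (h *\<^sub>R w), h *\<^sub>R w) (0, e)) has_vector_derivative
      (\<Sum>e\<in>Basis. (q 0 \<bullet> e) *\<^sub>R (- mixed w e) + ((mixed ?y w + v) \<bullet> e) *\<^sub>R D (- (0 *\<^sub>R w), 0 *\<^sub>R w) (0, e))) (at 0)"
    by (intro has_vector_derivative_sum has_vector_derivative_scaleR De qe)
  moreover have "(\<Sum>e\<in>Basis. (q 0 \<bullet> e) *\<^sub>R (- mixed w e) + ((mixed ?y w + v) \<bullet> e) *\<^sub>R D (- (0 *\<^sub>R w), 0 *\<^sub>R w) (0, e))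
      = v + lie_br gm ?y w"
  proof -
    have "(\<Sum>e\<in>Basis. (?y \<bullet> e) *\<^sub>R mixed w e) = mixed w (\<Sum>e\<in>Basis. (?y \<bullet> e) *\<^sub>R e)"
      by (simp add: linear_sum[OF linear_mixed_right] linear_cmul[OF linear_mixed_right])
    also have "\<dots> = mixed w ?y" by (simp only: euclidean_representation)
    finally have 1: "(\<Sum>e\<in>Basis. (?y \<bullet> e) *\<^sub>R mixed w e) = mixed w ?y" .
    have 2: "(\<Sum>e\<in>Basis. ((mixed ?y w + v) \<bullet> e) *\<^sub>R D (- (0 *\<^sub>R w), 0 *\<^sub>R w) (0, e)) = mixed ?y w + v"
      by (simp only: scaleR_zero_left minus_zero D_zero_left euclidean_representation)
    show ?thesis 
      unfolding sum.distrib 2 by (simp add: q0 sum_negf 1 lie_br_eq)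
  qed
  ultimately have "((\<lambda>h. ltriv w v (t + h)) has_vector_derivative v + lie_br gm ?y w) (at 0)"
    unfolding ltriv_add q expand[symmetric] by (simp only: expand[symmetric])
  moreover have "((\<lambda>s. s - t) has_vector_derivative 1) (at t)"
    by (auto simp flip: has_real_derivative_iff_has_vector_derivative intro!: derivative_eq_intros)
  ultimately show ?thesis
    using vector_diff_chain_at[of "\<lambda>s. s - t" 1 t "\<lambda>h. ltriv w v (t + h)"] 
    by (simp add: o_def)
qed

section \<open>The left-invariant frame: horizontal components, nondegeneracy, continuity\<close>

lemma D_neg_frame: "D (- x, x) (0, D (x, 0) (0, u)) = u"
proof -
  have "((\<lambda>t. gm (- x) (gm x (t *\<^sub>R u))) has_vector_derivative 
      D (- x, gm x (0 *\<^sub>R u)) (0, D (x, 0 *\<^sub>R u) (0, u))) (at 0)"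
    by (intro curve_deriv has_vector_derivative_const ray_deriv)
  moreover have "((\<lambda>t. gm (- x) (gm x (t *\<^sub>R u))) has_vector_derivative u) (at 0)"
    using ray_deriv by (simp add: neg_left left_zero flip: assoc)
  ultimately show ?thesis using vector_derivative_unique_at by (fastforce simp: right_zero)
qed

text \<open>The bracket in the equation for \<open>ltriv\<close> has no component along
  \<open>b\<close>, so that component grows linearly with slope \<open>b \<bullet> v\<close>.
  Consequently every left-invariant field differentiates a horizontal coordinate to a
  constant.\<close>

lemma horizontal_inner_frame:
  assumes b: "b \<in> V 1"
  shows "b \<bullet> D (x, 0) (0, u) = b \<bullet> u"
proof -
  have "b \<bullet> ltriv w v 1 - 1 * (b \<bullet> v) = b \<bullet> ltriv w v 0 - 0 * (b \<bullet> v)" for w v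
  proof (rule DERIV_isconst_all[rule_format, of "\<lambda>t. b \<bullet> ltriv w v t - t * (b \<bullet> v)"])
    fix t
    have "((\<lambda>t. b \<bullet> ltriv w v t) has_real_derivative b \<bullet> (v + lie_br gm (ltriv w v t) w)) (at t)"
      using bounded_linear.has_vector_derivative[OF bounded_linear_inner_right ltriv_deriv]
      by (simp add: has_real_derivative_iff_has_vector_derivative)
    then show "((\<lambda>t. b \<bullet> ltriv w v t - t * (b \<bullet> v)) has_real_derivative 0) (at t)"
      by (auto intro!: derivative_eq_intros simp: inner_add_right inner_lie_br[OF b])
  qed
  \<comment> \<open>Time 1 on the ray through \<open>w = x\<close>. This concerns translation by
    \<open>- x\<close>; inserting the frame vector for \<open>v\<close> and cancelling with
    \<open>D_neg_frame\<close> gives the claim for the field itself.\<close>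
  then have "b \<bullet> D (- x, x) (0, v) = b \<bullet> v" for v
    using linear_0[OF linear_D] by (fastforce simp: ltriv_def zero_prod_def)
  from this[of "D (x, 0) (0, u)"] show ?thesis by (simp add: D_neg_frame)
qed

text \<open>Absence of zeros makes the density of \<open>vG\<close> continuous, hence bounded on the
  compact closure of \<open>Om\<close>; this is how the measure on \<open>Om\<close> becomes
  finite.\<close>

lemma det_lframe_nz: "det (lframe gm x) \<noteq> 0"
proof -
  have "linear (\<lambda>u. (0, u) :: (real^'n) \<times> (real^'n))" by (rule linearI) auto
  from linear_compose[OF this linear_D] have lin: "linear (\<lambda>u. D (x, 0) (0, u))" by (simp add: o_def)
  have "lvf gm v (\<lambda>y. y $ i) x = deriv (\<lambda>t. gm x (t *\<^sub>R v) $ i) 0" for v i by (simp add: lvf_def)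
  then have "lframe gm x = matrix (\<lambda>u. D (x, 0) (0, u))"
    by (simp add: lframe_def matrix_def lvf_coord flip: lvf_def[of gm _ "\<lambda>y. y $ _"])
  moreover have "inj (\<lambda>u. D (x, 0) (0, u))"
    by (rule inj_on_inverseI[of _ "\<lambda>z. D (- x, x) (0, z)"]) (rule D_neg_frame)
  moreover have "(*v) (matrix (\<lambda>u. D (x, 0) (0, u))) = (\<lambda>u. D (x, 0) (0, u))"
    by (rule matrix_vector_mul(2)[OF lin])
  ultimately have "inj ((*v) (lframe gm x))" by simp
  then show ?thesis
    by (simp add: matrix_left_invertible_injective invertible_left_inverse flip: invertible_det_nz)
qed

lemma continuous_frame: "continuous_on S (\<lambda>x. D (x, 0) (0, v))"
proof -
  have "continuous_on UNIV (\<lambda>p. D p (0, v))"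
    using differentiable_imp_continuous_within[OF D_differentiable] by (simp add: continuous_on_eq_continuous_at)
  then show ?thesis by (rule continuous_on_compose2) (auto intro!: continuous_intros)
qed

lemma continuous_det_lframe: "continuous_on S (\<lambda>x. det (lframe gm x))"
proof -
  have "lframe gm x $ i $ j = D (x, 0) (0, axis j 1) $ i" for x i j
    by (simp add: lframe_def flip: fun_cong[OF lvf_coord]) (simp add: lvf_def)
  then show ?thesis unfolding det_def by (auto intro!: continuous_intros continuous_frame)
qed

text \<open>If the first layer were trivial, all layers would be, being generated from it by
  brackets, and could not span a space that contains a coordinate vector. The lemma excludes
  \<open>d = 0\<close>, where division by \<open>d\<close> would be meaningless.\<close>

lemma dim_V1_pos: "0 < dim (V 1)"
proof (rule ccontr)
  assume "\<not> 0 < dim (V 1)"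
  then have V1: "V 1 \<subseteq> {0}" by simp
  have "lvf gm 0 f = (\<lambda>x. 0)" for f by (simp add: lvf_def fun_eq_iff)
  moreover have "lvf gm w (\<lambda>x. 0) = (\<lambda>x. 0)" for w by (simp add: lvf_def fun_eq_iff)
  ultimately have br0: "lie_br gm 0 w = 0" for w by (simp add: lie_br_def vec_eq_iff)
  have "V j \<subseteq> {0}" if j: "1 \<le> j" "j \<le> r" for j
  proof (cases "j = 1")
    case False
    then obtain j' where "j = Suc j'" "1 \<le> j'" "j' < r" using j by (cases j) auto
    then have "V j = span {lie_br gm v w | v w. v \<in> V 1 \<and> w \<in> V j'}" using V_Suc by simp
    also have "\<dots> \<subseteq> span {0}" using V1 br0 by (intro span_mono) auto
    finally show ?thesis by simp
  qed (use V1 in simp)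
  then have "span (\<Union>j\<in>{1..r}. V j) \<subseteq> span {0}" by (intro span_mono) fastforce
  then have "(UNIV :: (real^'n) set) \<subseteq> {0}" using span_V by simp
  then have "(axis undefined 1 :: real^'n) = 0" by blast
  then show False by (simp add: axis_eq_0_iff)
qed

end

subsection \<open>Horizontal Sobolev functions on a bounded domain\<close>

lemma L2_tendsto_mult_bounded:
  assumes "\<And>n. L2 M (fs n)" "L2 M f" and g: "g \<in> borel_measurable M" "\<And>x. x \<in> space M \<Longrightarrow> \<bar>g x\<bar> \<le> C"
    and lim: "(\<lambda>n. \<integral>x. (fs n x - f x)\<^sup>2 \<partial>M) \<longlonglongrightarrow> 0"
  shows "(\<lambda>n. \<integral>x. (g x * fs n x - g x * f x)\<^sup>2 \<partial>M) \<longlonglongrightarrow> 0"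
proof (rule tendsto_sandwich[OF _ _ tendsto_const])
  have L2d: "L2 M (\<lambda>x. fs n x - f x)" for n using assms(1,2) by (rule L2_diff)
  have "(\<integral>x. (g x * fs n x - g x * f x)\<^sup>2 \<partial>M) \<le> (\<integral>x. C\<^sup>2 * (fs n x - f x)\<^sup>2 \<partial>M)" for n
  proof (rule integral_mono)
    show "integrable M (\<lambda>x. C\<^sup>2 * (fs n x - f x)\<^sup>2)" using L2d by (simp add: L2_def)
    show "integrable M (\<lambda>x. (g x * fs n x - g x * f x)\<^sup>2)"
      using L2_mult_bounded[OF L2d g] by (simp add: L2_def right_diff_distrib)
    fix x assume "x \<in> space M"
    from g(2)[OF this] have "(g x)\<^sup>2 \<le> C\<^sup>2" using power_mono[of "\<bar>g x\<bar>" C 2] by simp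
    then show "(g x * fs n x - g x * f x)\<^sup>2 \<le> C\<^sup>2 * (fs n x - f x)\<^sup>2"
      by (simp add: mult_right_mono power_mult_distrib flip: right_diff_distrib)
  qed
  then show "\<forall>\<^sub>F n in sequentially. (\<integral>x. (g x * fs n x - g x * f x)\<^sup>2 \<partial>M) \<le> C\<^sup>2 * (\<integral>x. (fs n x - f x)\<^sup>2 \<partial>M)"
    by simp
  show "(\<lambda>n. C\<^sup>2 * (\<integral>x. (fs n x - f x)\<^sup>2 \<partial>M)) \<longlonglongrightarrow> 0"
    using tendsto_mult_right_zero[OF lim] .
qed simp

lemma L2_tendsto_add:
  assumes "\<And>n. L2 M (fs n)" "L2 M f" "\<And>n. L2 M (gs n)" "L2 M g"
    and lim: "(\<lambda>n. \<integral>x. (fs n x - f x)\<^sup>2 \<partial>M) \<longlonglongrightarrow> 0" "(\<lambda>n. \<integral>x. (gs n x - g x)\<^sup>2 \<partial>M) \<longlonglongrightarrow> 0"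
  shows "(\<lambda>n. \<integral>x. ((fs n x + gs n x) - (f x + g x))\<^sup>2 \<partial>M) \<longlonglongrightarrow> 0"
proof (rule tendsto_sandwich[OF _ _ tendsto_const])
  have L2d: "L2 M (\<lambda>x. fs n x - f x)" "L2 M (\<lambda>x. gs n x - g x)" for n using assms by (auto intro: L2_diff)
  have "(\<integral>x. ((fs n x + gs n x) - (f x + g x))\<^sup>2 \<partial>M) \<le> (\<integral>x. 2 * (fs n x - f x)\<^sup>2 + 2 * (gs n x - g x)\<^sup>2 \<partial>M)" for n
  proof (rule integral_mono)
    show "integrable M (\<lambda>x. 2 * (fs n x - f x)\<^sup>2 + 2 * (gs n x - g x)\<^sup>2)" using L2d by (simp add: L2_def)
    show "integrable M (\<lambda>x. ((fs n x + gs n x) - (f x + g x))\<^sup>2)"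
      using L2_add[OF L2d, of n] by (simp add: L2_def algebra_simps)
    fix x
    have "(a + b)\<^sup>2 \<le> 2 * a\<^sup>2 + 2 * b\<^sup>2" for a b :: real
      using sum_squares_bound[of a b] by (simp add: power2_sum)
    from this[of "fs n x - f x" "gs n x - g x"]
    show "((fs n x + gs n x) - (f x + g x))\<^sup>2 \<le> 2 * (fs n x - f x)\<^sup>2 + 2 * (gs n x - g x)\<^sup>2"
      by (simp add: algebra_simps)
  qed
  then show "\<forall>\<^sub>F n in sequentially. (\<integral>x. ((fs n x + gs n x) - (f x + g x))\<^sup>2 \<partial>M)
      \<le> 2 * (\<integral>x. (fs n x - f x)\<^sup>2 \<partial>M) + 2 * (\<integral>x. (gs n x - g x)\<^sup>2 \<partial>M)"
    using L2d by (simp add: L2_def)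
  show "(\<lambda>n. 2 * (\<integral>x. (fs n x - f x)\<^sup>2 \<partial>M) + 2 * (\<integral>x. (gs n x - g x)\<^sup>2 \<partial>M)) \<longlonglongrightarrow> 0"
    using tendsto_add[OF tendsto_mult_right_zero[OF lim(1)] tendsto_mult_right_zero[OF lim(2)], of 2 2] by simp
qed simp

locale carnot_domain = carnot gm V r
  for gm :: "real^'n \<Rightarrow> real^'n \<Rightarrow> real^'n" and V :: "nat \<Rightarrow> (real^'n) set" and r :: nat +
  fixes Om :: "(real^'n) set" and d :: nat and b :: "nat \<Rightarrow> real^'n"
  assumes open_Om: "open Om" and bounded_Om: "bounded Om"
    and b_V1: "j < d \<Longrightarrow> b j \<in> V 1"
    and b_orthonormal: "i < d \<Longrightarrow> j < d \<Longrightarrow> b i \<bullet> b j = (if i = j then 1 else 0)"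
begin

abbreviation M :: "(real^'n) measure" where "M \<equiv> dom_meas gm Om"

lemma space_M: "space M = Om"
  by (simp add: dom_meas_def space_restrict_space vG_def)

lemma borel_measurable_M: "f \<in> borel_measurable borel \<Longrightarrow> f \<in> borel_measurable M"
  unfolding dom_meas_def by (rule measurable_restrict_space1) (simp add: vG_def)

lemma compact_closure_Om: "compact (closure Om)"
  using bounded_Om by (simp add: compact_closure)

lemma finite_M: "finite_measure M"
proof
  have cont: "continuous_on S (\<lambda>x. 1 / \<bar>det (lframe gm x)\<bar>)" for S
    by (intro continuous_intros continuous_det_lframe) (simp add: det_lframe_nz)
  have "bounded ((\<lambda>x. 1 / \<bar>det (lframe gm x)\<bar>) ` closure Om)"
    by (intro compact_imp_bounded compact_continuous_image cont compact_closure_Om)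
  then obtain C where C: "\<And>x. x \<in> closure Om \<Longrightarrow> 1 / \<bar>det (lframe gm x)\<bar> \<le> C"
    unfolding bounded_iff by (auto simp: abs_le_iff)
  have "emeasure M (space M) = emeasure (vG gm) Om"
    using open_Om by (simp add: space_M dom_meas_def emeasure_restrict_space vG_def)
  also have "\<dots> = (\<integral>\<^sup>+x. ennreal (1 / \<bar>det (lframe gm x)\<bar>) * indicator Om x \<partial>lborel)"
    unfolding vG_def using open_Om borel_measurable_continuous_onI[OF cont]
    by (intro emeasure_density) auto
  also have "\<dots> \<le> (\<integral>\<^sup>+x. ennreal C * indicator Om x \<partial>lborel)"
    using C closure_subset[of Om] by (intro nn_integral_mono) (auto intro!: ennreal_leI split: split_indicator)
  also have "\<dots> = ennreal C * emeasure lborel Om"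
    using open_Om by (simp add: nn_integral_cmult_indicator)
  also have "\<dots> < \<infinity>"
    using emeasure_bounded_finite[OF bounded_Om] by (simp add: ennreal_mult_less_top)
  finally show "emeasure M (space M) \<noteq> \<infinity>" by simp
qed

lemma bounded_on_Om:
  fixes f :: "real^'n \<Rightarrow> real"
  assumes "continuous_on UNIV f"
  obtains C where "\<And>x. x \<in> Om \<Longrightarrow> \<bar>f x\<bar> \<le> C"
proof -
  have "bounded (f ` closure Om)"
    using assms compact_closure_Om 
    by (intro compact_imp_bounded compact_continuous_image) (auto intro: continuous_on_subset)
  then obtain C where C: "\<And>x. x \<in> closure Om \<Longrightarrow> \<bar>f x\<bar> \<le> C" unfolding bounded_iff by auto
  have "\<bar>f x\<bar> \<le> C" if "x \<in> Om" for x using that C closure_subset by blast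
  then show thesis by (rule that)
qed

lemma L2_continuous:
  fixes f :: "real^'n \<Rightarrow> real"
  assumes "continuous_on UNIV f"
  shows "L2 M f"
proof -
  obtain C where "\<And>x. x \<in> Om \<Longrightarrow> \<bar>f x\<bar> \<le> C" using bounded_on_Om[OF assms] by blast
  then show ?thesis
    using assms by (intro L2_bounded finite_M borel_measurable_M borel_measurable_continuous_onI) (auto simp: space_M)
qed

lemma coord_bounded: obtains C where "\<And>x. x \<in> Om \<Longrightarrow> \<bar>a \<bullet> x\<bar> \<le> C"
  by (rule bounded_on_Om[of "\<lambda>x. a \<bullet> x"]) (auto intro!: continuous_intros)

lemma coord_measurable: "(\<lambda>x. a \<bullet> x) \<in> borel_measurable M"
  by (intro borel_measurable_M) simp

lemma L2_coord_mult: "L2 M f \<Longrightarrow> L2 M (\<lambda>x. (a \<bullet> x) * f x)"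
  by (rule coord_bounded[of a]) (rule L2_mult_bounded, auto simp: coord_measurable space_M)

lemma test_fun_L2:
  assumes "test_fun Om \<phi>"
  shows "L2 M \<phi>" "L2 M (lvf gm v \<phi>)"
proof -
  have sm: "smooth_on UNIV \<phi>" using assms by (simp add: test_fun_def)
  then have df: "\<phi> differentiable (at x)" for x by (simp add: smooth_on_imp_differentiable)
  then show "L2 M \<phi>"
    by (intro L2_continuous) (simp add: continuous_on_eq_continuous_at differentiable_imp_continuous_within)
  have "lvf gm v \<phi> x = (\<Sum>e\<in>Basis. (D (x, 0) (0, v) \<bullet> e) * frechet_derivative \<phi> (at x) e)" for x
  proof -
    have d: "(\<phi> has_derivative frechet_derivative \<phi> (at x)) (at x)"
      using df by (simp flip: frechet_derivative_works)
    note lin = has_derivative_linear[OF d]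
    have "frechet_derivative \<phi> (at x) (\<Sum>e\<in>Basis. (z \<bullet> e) *\<^sub>R e)
        = (\<Sum>e\<in>Basis. (z \<bullet> e) * frechet_derivative \<phi> (at x) e)" for z
      by (simp add: linear_sum[OF lin] linear_cmul[OF lin])
    from this[of "D (x, 0) (0, v)"] show ?thesis by (simp only: lvf_eq[OF d] euclidean_representation)
  qed
  moreover have "continuous_on UNIV (\<lambda>x. frechet_derivative \<phi> (at x) e)" for e
    using smooth_on_frechet_derivative_differentiable[OF sm]
    by (simp add: continuous_on_eq_continuous_at differentiable_imp_continuous_within)
  then have "continuous_on UNIV (\<lambda>x. \<Sum>e\<in>Basis. (D (x, 0) (0, v) \<bullet> e) * frechet_derivative \<phi> (at x) e)"
    by (intro continuous_intros continuous_frame)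
  ultimately have "continuous_on UNIV (lvf gm v \<phi>)" by presburger
  then show "L2 M (lvf gm v \<phi>)" by (rule L2_continuous)
qed

section \<open>Multiplication by horizontal coordinates\<close>

lemma test_fun_coord_mult:
  assumes "test_fun Om \<phi>"
  shows "test_fun Om (\<lambda>x. (a \<bullet> x) * \<phi> x)"
proof -
  have sub: "tsupp (\<lambda>x. (a \<bullet> x) * \<phi> x) \<subseteq> tsupp \<phi>"
    unfolding tsupp_def by (rule closure_mono) auto
  moreover have "compact (tsupp (\<lambda>x. (a \<bullet> x) * \<phi> x))"
    using assms sub unfolding compact_eq_bounded_closed
    by (auto simp: test_fun_def tsupp_def compact_eq_bounded_closed intro: bounded_subset)
  ultimately show ?thesis using assms by (auto simp: test_fun_def smooth_on_inner_mult)
qed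

lemma lvf_coord_mult:
  assumes "test_fun Om \<phi>" "a \<in> V 1"
  shows "lvf gm v (\<lambda>x. (a \<bullet> x) * \<phi> x) x = (a \<bullet> x) * lvf gm v \<phi> x + (a \<bullet> v) * \<phi> x"
proof -
  have d: "(\<phi> has_derivative frechet_derivative \<phi> (at x)) (at x)"
    using assms smooth_on_imp_differentiable[of UNIV \<phi> x] by (simp add: test_fun_def flip: frechet_derivative_works)
  then have "((\<lambda>x. (a \<bullet> x) * \<phi> x) has_derivative 
      (\<lambda>h. (a \<bullet> x) * frechet_derivative \<phi> (at x) h + (a \<bullet> h) * \<phi> x)) (at x)"
    by (auto intro!: derivative_eq_intros)
  from lvf_eq[OF this, of v] lvf_eq[OF d, of v] show ?thesis
    by (simp add: horizontal_inner_frame[OF assms(2)])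
qed

text \<open>Multiplication by \<open>a \<bullet> x\<close> preserves test functions, so it may be
  moved onto the test function in the weak identity and applied to the approximating sequence. As
  the factor is bounded on \<open>Om\<close>, both convergences survive.\<close>

lemma hsob0_coord_mult:
  assumes f: "hsob0 gm Om b d f G" and a: "a \<in> V 1"
  shows "hsob0 gm Om b d (\<lambda>x. (a \<bullet> x) * f x) (\<lambda>j x. (a \<bullet> x) * G j x + (a \<bullet> b j) * f x)"
proof -
  have L2f: "L2 M f" using f by (simp add: hsob0_def)
  have L2G: "L2 M (G j)" if "j < d" for j using f that by (simp add: hsob0_def weak_lvf_def)
  from f obtain \<phi>s where \<phi>s: "\<And>m. test_fun Om (\<phi>s m)" "(\<lambda>m. \<integral>x. (\<phi>s m x - f x)\<^sup>2 \<partial>M) \<longlonglongrightarrow> 0"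
    "\<And>j. j < d \<Longrightarrow> (\<lambda>m. \<integral>x. (lvf gm (b j) (\<phi>s m) x - G j x)\<^sup>2 \<partial>M) \<longlonglongrightarrow> 0"
    by (auto simp: hsob0_def)
  obtain C where C: "\<And>x. x \<in> space M \<Longrightarrow> \<bar>a \<bullet> x\<bar> \<le> C" using coord_bounded[of a] by (auto simp: space_M)
  have weak: "weak_lvf gm Om (b j) (\<lambda>x. (a \<bullet> x) * f x) (\<lambda>x. (a \<bullet> x) * G j x + (a \<bullet> b j) * f x)" if j: "j < d" for j
    unfolding weak_lvf_def
  proof (intro conjI allI impI)
    show "L2 M (\<lambda>x. (a \<bullet> x) * G j x + (a \<bullet> b j) * f x)"
      using L2f L2G[OF j] by (intro L2_add L2_coord_mult L2_cmult)
    fix \<phi> assume \<phi>: "test_fun Om \<phi>"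
    note int = L2_mult_integrable
    have i1: "integrable M (\<lambda>x. f x * lvf gm (b j) (\<lambda>x. (a \<bullet> x) * \<phi> x) x)"
      using L2f test_fun_L2(2)[OF test_fun_coord_mult[OF \<phi>]] by (rule int)
    have i2: "integrable M (\<lambda>x. f x * \<phi> x)" using L2f test_fun_L2(1)[OF \<phi>] by (rule int)
    have i3: "integrable M (\<lambda>x. G j x * ((a \<bullet> x) * \<phi> x))"
      using L2G[OF j] test_fun_L2(1)[OF test_fun_coord_mult[OF \<phi>]] by (rule int)
    have "(\<integral>x. (a \<bullet> x) * f x * lvf gm (b j) \<phi> x \<partial>M)
        = (\<integral>x. f x * lvf gm (b j) (\<lambda>x. (a \<bullet> x) * \<phi> x) x - (a \<bullet> b j) * (f x * \<phi> x) \<partial>M)"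
      by (rule Bochner_Integration.integral_cong) (unfold lvf_coord_mult[OF \<phi> a], simp_all add: algebra_simps)
    also have "\<dots> = (\<integral>x. f x * lvf gm (b j) (\<lambda>x. (a \<bullet> x) * \<phi> x) x \<partial>M) - (a \<bullet> b j) * (\<integral>x. f x * \<phi> x \<partial>M)"
      using i1 i2 by simp
    also have "(\<integral>x. f x * lvf gm (b j) (\<lambda>x. (a \<bullet> x) * \<phi> x) x \<partial>M) = - (\<integral>x. G j x * ((a \<bullet> x) * \<phi> x) \<partial>M)"
      using f j test_fun_coord_mult[OF \<phi>] by (simp add: hsob0_def weak_lvf_def)
    also have "- (\<integral>x. G j x * ((a \<bullet> x) * \<phi> x) \<partial>M) - (a \<bullet> b j) * (\<integral>x. f x * \<phi> x \<partial>M)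
        = - (\<integral>x. G j x * ((a \<bullet> x) * \<phi> x) + (a \<bullet> b j) * (f x * \<phi> x) \<partial>M)"
      using i2 i3 by simp
    also have "\<dots> = - (\<integral>x. ((a \<bullet> x) * G j x + (a \<bullet> b j) * f x) * \<phi> x \<partial>M)"
      by (simp add: algebra_simps)
    finally show "(\<integral>x. (a \<bullet> x) * f x * lvf gm (b j) \<phi> x \<partial>M)
      = - (\<integral>x. ((a \<bullet> x) * G j x + (a \<bullet> b j) * f x) * \<phi> x \<partial>M)" .
  qed
  have lim0: "(\<lambda>m. \<integral>x. ((a \<bullet> x) * \<phi>s m x - (a \<bullet> x) * f x)\<^sup>2 \<partial>M) \<longlonglongrightarrow> 0"
    by (rule L2_tendsto_mult_bounded[OF test_fun_L2(1)[OF \<phi>s(1)] L2f coord_measurable C \<phi>s(2)])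
  have lim1: "(\<lambda>m. \<integral>x. (lvf gm (b j) (\<lambda>x. (a \<bullet> x) * \<phi>s m x) x - ((a \<bullet> x) * G j x + (a \<bullet> b j) * f x))\<^sup>2 \<partial>M) \<longlonglongrightarrow> 0"
    if j: "j < d" for j
  proof -
    have "(\<lambda>m. \<integral>x. (((a \<bullet> x) * lvf gm (b j) (\<phi>s m) x + (a \<bullet> b j) * \<phi>s m x) 
        - ((a \<bullet> x) * G j x + (a \<bullet> b j) * f x))\<^sup>2 \<partial>M) \<longlonglongrightarrow> 0"
    proof (rule L2_tendsto_add)
      show "(\<lambda>m. \<integral>x. ((a \<bullet> x) * lvf gm (b j) (\<phi>s m) x - (a \<bullet> x) * G j x)\<^sup>2 \<partial>M) \<longlonglongrightarrow> 0"
        by (rule L2_tendsto_mult_bounded[OF test_fun_L2(2)[OF \<phi>s(1)] L2G[OF j] coord_measurable C \<phi>s(3)[OF j]])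
      show "(\<lambda>m. \<integral>x. ((a \<bullet> b j) * \<phi>s m x - (a \<bullet> b j) * f x)\<^sup>2 \<partial>M) \<longlonglongrightarrow> 0"
        by (rule L2_tendsto_mult_bounded[OF test_fun_L2(1)[OF \<phi>s(1)] L2f _ _ \<phi>s(2)]) auto
    qed (intro L2_coord_mult L2_cmult test_fun_L2[OF \<phi>s(1)] L2f L2G j)+
    then show ?thesis by (simp add: lvf_coord_mult[OF \<phi>s(1) a])
  qed
  show ?thesis
    unfolding hsob0_def using L2_coord_mult[OF L2f] weak lim0 lim1 test_fun_coord_mult[OF \<phi>s(1)]
    by (intro conjI exI[of _ "\<lambda>m x. (a \<bullet> x) * \<phi>s m x"]) auto
qed

text \<open>Only \<open>h\<close> is approximated by test functions; for \<open>f\<close> the weak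
  identity is used directly. The Dirichlet condition enters as the existence of that
  approximation.\<close>

lemma hsob0_integration_by_parts:
  assumes f: "hsob0 gm Om b d f G" and h: "hsob0 gm Om b d h H" and j: "j < d"
  shows "(\<integral>x. G j x * h x \<partial>M) = - (\<integral>x. f x * H j x \<partial>M)"
proof -
  have L2: "L2 M f" "L2 M h" "L2 M (G j)" "L2 M (H j)"
    using f h j by (simp_all add: hsob0_def weak_lvf_def)
  from h j obtain \<phi>s where \<phi>s: "\<And>m. test_fun Om (\<phi>s m)" "(\<lambda>m. \<integral>x. (\<phi>s m x - h x)\<^sup>2 \<partial>M) \<longlonglongrightarrow> 0"
    "(\<lambda>m. \<integral>x. (lvf gm (b j) (\<phi>s m) x - H j x)\<^sup>2 \<partial>M) \<longlonglongrightarrow> 0"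
    by (auto simp: hsob0_def)
  have "(\<lambda>m. \<integral>x. lvf gm (b j) (\<phi>s m) x * f x \<partial>M) \<longlonglongrightarrow> (\<integral>x. H j x * f x \<partial>M)"
    by (rule L2_tendsto_inner[OF test_fun_L2(2)[OF \<phi>s(1)] L2(4,1) \<phi>s(3)])
  moreover have "(\<lambda>m. - (\<integral>x. \<phi>s m x * G j x \<partial>M)) \<longlonglongrightarrow> - (\<integral>x. h x * G j x \<partial>M)"
    by (intro tendsto_minus L2_tendsto_inner[OF test_fun_L2(1)[OF \<phi>s(1)] L2(2,3) \<phi>s(2)])
  moreover have "(\<integral>x. lvf gm (b j) (\<phi>s m) x * f x \<partial>M) = - (\<integral>x. \<phi>s m x * G j x \<partial>M)" for m
    using f j \<phi>s(1)[of m] by (simp add: hsob0_def weak_lvf_def mult.commute)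
  ultimately have "(\<integral>x. H j x * f x \<partial>M) = - (\<integral>x. h x * G j x \<partial>M)"
    by (simp only: LIMSEQ_unique)
  then show ?thesis by (simp add: mult.commute)
qed

lemma form_dom_coord_mult:
  assumes f: "form_dom gm Om b d W f G" and a: "a \<in> V 1" and W: "W \<in> borel_measurable M"
  shows "form_dom gm Om b d W (\<lambda>x. (a \<bullet> x) * f x) (\<lambda>j x. (a \<bullet> x) * G j x + (a \<bullet> b j) * f x)"
  unfolding form_dom_def
proof
  show "hsob0 gm Om b d (\<lambda>x. (a \<bullet> x) * f x) (\<lambda>j x. (a \<bullet> x) * G j x + (a \<bullet> b j) * f x)"
    using f a by (intro hsob0_coord_mult) (auto simp: form_dom_def)
  obtain C where C: "\<And>x. x \<in> space M \<Longrightarrow> \<bar>a \<bullet> x\<bar> \<le> C" using coord_bounded[of a] by (auto simp: space_M)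
  have [measurable]: "f \<in> borel_measurable M" using f by (simp add: form_dom_def hsob0_def L2_def)
  note [measurable] = coord_measurable[of a] W
  show "integrable M (\<lambda>x. W x * ((a \<bullet> x) * f x)\<^sup>2)"
  proof (rule Bochner_Integration.integrable_bound)
    show "integrable M (\<lambda>x. C\<^sup>2 * (W x * (f x)\<^sup>2))" using f by (simp add: form_dom_def)
    have "\<bar>W x * ((a \<bullet> x) * f x)\<^sup>2\<bar> \<le> \<bar>C\<^sup>2 * (W x * (f x)\<^sup>2)\<bar>" if "x \<in> space M" for x
    proof -
      have "(a \<bullet> x)\<^sup>2 \<le> C\<^sup>2" using C[OF that] power_mono[of "\<bar>a \<bullet> x\<bar>" C 2] by simp
      then have "(a \<bullet> x)\<^sup>2 * \<bar>W x * (f x)\<^sup>2\<bar> \<le> C\<^sup>2 * \<bar>W x * (f x)\<^sup>2\<bar>" by (rule mult_right_mono) simp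
      then show ?thesis by (simp add: abs_mult power_mult_distrib mult_ac)
    qed
    then show "AE x in M. norm (W x * ((a \<bullet> x) * f x)\<^sup>2) \<le> norm (C\<^sup>2 * (W x * (f x)\<^sup>2))" by auto
  qed measurable
qed

lemma form_dom_potential_integrable:
  assumes f: "form_dom gm Om b d W f G" and h: "form_dom gm Om b d W h H" and W: "W \<in> borel_measurable M"
  shows "integrable M (\<lambda>x. W x * f x * h x)"
proof (rule Bochner_Integration.integrable_bound)
  have [measurable]: "f \<in> borel_measurable M" "h \<in> borel_measurable M"
    using f h by (simp_all add: form_dom_def hsob0_def L2_def)
  note [measurable] = W
  show "integrable M (\<lambda>x. \<bar>W x * (f x)\<^sup>2\<bar> + \<bar>W x * (h x)\<^sup>2\<bar>)"
    using f h by (simp add: form_dom_def)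
  have "\<bar>w * s * t\<bar> \<le> \<bar>w * s\<^sup>2\<bar> + \<bar>w * t\<^sup>2\<bar>" for w s t :: real
  proof -
    have "2 * \<bar>s * t\<bar> \<le> s\<^sup>2 + t\<^sup>2" using sum_squares_bound[of "\<bar>s\<bar>" "\<bar>t\<bar>"] by (simp add: abs_mult)
    then have "\<bar>s * t\<bar> \<le> s\<^sup>2 + t\<^sup>2" using abs_ge_zero[of "s * t"] by linarith
    from mult_left_mono[OF this, of "\<bar>w\<bar>"] show ?thesis by (simp add: abs_mult distrib_left mult.assoc)
  qed
  then show "AE x in M. norm (W x * f x * h x) \<le> norm (\<bar>W x * (f x)\<^sup>2\<bar> + \<bar>W x * (h x)\<^sup>2\<bar>)"
    by auto
  show "(\<lambda>x. W x * f x * h x) \<in> borel_measurable M" by measurable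
qed

end

subsection \<open>Universal eigenvalue inequalities\<close>

context carnot_domain
begin

text \<open>The equation of \<open>h\<close> is tested with \<open>g f\<close> and that of
  \<open>f\<close> with \<open>g h\<close>. On subtracting, the potential and the terms
  \<open>g F m H m\<close> cancel, and orthonormality leaves \<open>H j f - F j h\<close>;
  integration by parts makes the two halves equal, which is the factor 2.\<close>

lemma eigenfunction_commutator:
  assumes j: "j < d" and W: "W \<in> borel_measurable M"
    and f: "form_dom gm Om b d W f F" and h: "form_dom gm Om b d W h H"
    and eqf: "\<And>\<phi> K. form_dom gm Om b d W \<phi> K \<Longrightarrow>
      (\<integral>x. (\<Sum>m<d. F m x * K m x) + W x * f x * \<phi> x \<partial>M) = \<kappa> * (\<integral>x. f x * \<phi> x \<partial>M)"
    and eqh: "\<And>\<phi> K. form_dom gm Om b d W \<phi> K \<Longrightarrow>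
      (\<integral>x. (\<Sum>m<d. H m x * K m x) + W x * h x * \<phi> x \<partial>M) = \<mu> * (\<integral>x. h x * \<phi> x \<partial>M)"
  shows "(\<mu> - \<kappa>) * (\<integral>x. (b j \<bullet> x) * f x * h x \<partial>M) = - 2 * (\<integral>x. F j x * h x \<partial>M)"
proof -
  have sob: "hsob0 gm Om b d f F" "hsob0 gm Om b d h H" using f h by (simp_all add: form_dom_def)
  have L2: "L2 M f" "L2 M h" "\<And>m. m < d \<Longrightarrow> L2 M (F m)" "\<And>m. m < d \<Longrightarrow> L2 M (H m)"
    using sob by (simp_all add: hsob0_def weak_lvf_def)
  let ?g = "\<lambda>x. b j \<bullet> x"
  note gf = form_dom_coord_mult[OF f b_V1[OF j] W]
  note gh = form_dom_coord_mult[OF h b_V1[OF j] W]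
  let ?A = "\<lambda>x. (\<Sum>m<d. H m x * (?g x * F m x + (b j \<bullet> b m) * f x)) + W x * h x * (?g x * f x)"
  let ?B = "\<lambda>x. (\<Sum>m<d. F m x * (?g x * H m x + (b j \<bullet> b m) * h x)) + W x * f x * (?g x * h x)"
  have A: "integrable M ?A"
    by (intro Bochner_Integration.integrable_add Bochner_Integration.integrable_sum L2_mult_integrable
      L2_add L2_coord_mult L2_cmult L2 form_dom_potential_integrable[OF h gf W]) auto
  have B: "integrable M ?B"
    by (intro Bochner_Integration.integrable_add Bochner_Integration.integrable_sum L2_mult_integrable
      L2_add L2_coord_mult L2_cmult L2 form_dom_potential_integrable[OF f gh W]) auto
  have diff: "?A x - ?B x = H j x * f x - F j x * h x" for x
  proof -
    have "?A x - ?B x = (\<Sum>m<d. (b j \<bullet> b m) * (H m x * f x - F m x * h x))"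
      by (simp add: algebra_simps flip: sum_subtractf)
    also have "\<dots> = (\<Sum>m<d. if j = m then H m x * f x - F m x * h x else 0)"
      using j by (intro sum.cong) (auto simp: b_orthonormal)
    finally show ?thesis using j by simp
  qed
  have "\<mu> * (\<integral>x. h x * (?g x * f x) \<partial>M) - \<kappa> * (\<integral>x. f x * (?g x * h x) \<partial>M) = (\<integral>x. ?A x - ?B x \<partial>M)"
    unfolding Bochner_Integration.integral_diff[OF A B] eqh[OF gf] eqf[OF gh] ..
  also have "\<dots> = (\<integral>x. H j x * f x \<partial>M) - (\<integral>x. F j x * h x \<partial>M)"
    unfolding diff using L2 j by (intro Bochner_Integration.integral_diff L2_mult_integrable) auto
  also have "(\<integral>x. H j x * f x \<partial>M) = - (\<integral>x. F j x * h x \<partial>M)"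
    using hsob0_integration_by_parts[OF sob(2,1) j] by (simp add: mult.commute)
  finally show ?thesis by (simp add: mult_ac left_diff_distrib)
qed

text \<open>Moving \<open>X j\<close> across \<open>g f\<close> reproduces the integral with
  opposite sign plus the norm of \<open>f\<close>, since \<open>X j g = 1\<close>.\<close>

lemma coord_gradient_inner:
  assumes "hsob0 gm Om b d f F" "j < d"
  shows "(\<integral>x. (b j \<bullet> x) * f x * F j x \<partial>M) = - (\<integral>x. (f x)\<^sup>2 \<partial>M) / 2"
proof -
  have L2: "L2 M f" "L2 M (F j)" using assms by (simp_all add: hsob0_def weak_lvf_def)
  have i: "integrable M (\<lambda>x. (b j \<bullet> x) * f x * F j x)" "integrable M (\<lambda>x. (f x)\<^sup>2)"
    using L2_mult_integrable[OF L2_coord_mult L2(2)] L2 by (auto simp: L2_def)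
  have "(\<integral>x. F j x * ((b j \<bullet> x) * f x) \<partial>M) = - (\<integral>x. f x * ((b j \<bullet> x) * F j x + (b j \<bullet> b j) * f x) \<partial>M)"
    by (rule hsob0_integration_by_parts[OF assms(1) hsob0_coord_mult[OF assms(1) b_V1] assms(2)]) fact
  also have "\<dots> = - (\<integral>x. (b j \<bullet> x) * f x * F j x + (f x)\<^sup>2 \<partial>M)"
    using b_orthonormal[OF assms(2) assms(2)] by (simp add: algebra_simps power2_eq_square)
  also have "\<dots> = - (\<integral>x. (b j \<bullet> x) * f x * F j x \<partial>M) - (\<integral>x. (f x)\<^sup>2 \<partial>M)" using i by simp
  finally show ?thesis by (simp add: mult_ac)
qed

theorem yang_type_inequality:
  assumes d: "0 < d" and spec: "discrete_dirichlet_spectrum gm Om b d W lam u"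
  shows "(\<Sum>i=1..k. (lam (k+1) - lam i) powr p)
    \<le> max 4 (2 * p) / real d * (\<Sum>i=1..k. (lam (k+1) - lam i) powr (p - 1) *
         (lam i - (\<integral>x. W x * (u i x)\<^sup>2 \<partial>M)))"
    and "1 \<le> i \<Longrightarrow> (\<integral>x. W x * (u i x)\<^sup>2 \<partial>M) \<le> lam i"
proof -
  have W: "W \<in> borel_measurable M"
    and eig: "\<forall>i. 1 \<le> i \<longrightarrow> dir_eigen gm Om b d W (lam i) (u i)"
    and Suc: "\<And>i. 1 \<le> i \<Longrightarrow> lam i \<le> lam (Suc i)"
    and ortho: "\<And>i l. 1 \<le> i \<Longrightarrow> 1 \<le> l \<Longrightarrow> (\<integral>x. u i x * u l x \<partial>M) = (if i = l then 1 else 0)"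
    and complete: "\<And>f. L2 M f \<Longrightarrow> (\<And>i. 1 \<le> i \<Longrightarrow> (\<integral>x. f x * u i x \<partial>M) = 0) \<Longrightarrow> AE x in M. f x = 0"
    using spec unfolding discrete_dirichlet_spectrum_def by blast+
  have mono: "lam i \<le> lam l" if "1 \<le> i" "i \<le> l" for i l
    using that(2) by (induction rule: dec_induct) (use that(1) Suc in \<open>auto intro: order_trans\<close>)
  have "\<forall>i. \<exists>G. 1 \<le> i \<longrightarrow> form_dom gm Om b d W (u i) G \<and> (\<forall>\<phi> H. form_dom gm Om b d W \<phi> H \<longrightarrow>
      (\<integral>x. (\<Sum>j<d. G j x * H j x) + W x * u i x * \<phi> x \<partial>M) = lam i * (\<integral>x. u i x * \<phi> x \<partial>M))"
    using eig unfolding dir_eigen_def by blast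
  then obtain G where G: "\<And>i. 1 \<le> i \<Longrightarrow> form_dom gm Om b d W (u i) (G i)"
    and weak: "\<And>i \<phi> H. 1 \<le> i \<Longrightarrow> form_dom gm Om b d W \<phi> H \<Longrightarrow>
          (\<integral>x. (\<Sum>j<d. G i j x * H j x) + W x * u i x * \<phi> x \<partial>M) = lam i * (\<integral>x. u i x * \<phi> x \<partial>M)"
    unfolding choice_iff by blast
  have sob: "hsob0 gm Om b d (u i) (G i)" if "1 \<le> i" for i using G[OF that] by (simp add: form_dom_def)
  have L2: "L2 M (u i)" "j < d \<Longrightarrow> L2 M (G i j)" if "1 \<le> i" for i j
    using sob[OF that] by (simp_all add: hsob0_def weak_lvf_def)
  interpret complete_orthonormal M u
    by unfold_locales (use L2 ortho complete in auto)
  define Q where "Q j i = (\<integral>x. (G i j x)\<^sup>2 \<partial>M)" for j i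
  have norm1: "(\<integral>x. (u i x)\<^sup>2 \<partial>M) = 1" if "1 \<le> i" for i
    using ortho[OF that that] by (simp add: power2_eq_square)
  \<comment> \<open>The equation of \<open>u i\<close> tested with \<open>u i\<close> itself. It
    makes the right-hand sides of \<open>part\<close> add up over \<open>j\<close> to the required
    factor, and positivity of the left-hand side gives the second claim.\<close>
  have energy: "(\<Sum>j<d. Q j i) = lam i - (\<integral>x. W x * (u i x)\<^sup>2 \<partial>M)" if i: "1 \<le> i" for i
  proof -
    have "(\<integral>x. (\<Sum>j<d. (G i j x)\<^sup>2) + W x * (u i x)\<^sup>2 \<partial>M) = lam i"
      using weak[OF i G[OF i]] norm1[OF i] by (simp add: power2_eq_square mult.assoc)
    moreover have "(\<integral>x. (\<Sum>j<d. (G i j x)\<^sup>2) + W x * (u i x)\<^sup>2 \<partial>M) = (\<Sum>j<d. Q j i) + (\<integral>x. W x * (u i x)\<^sup>2 \<partial>M)"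
    proof -
      have "integrable M (\<lambda>x. (G i j x)\<^sup>2)" if "j < d" for j using L2(2)[OF i that] by (simp add: L2_def)
      then show ?thesis
        using G[OF i] unfolding Q_def form_dom_def
        by (subst Bochner_Integration.integral_add) (auto intro!: Bochner_Integration.integrable_sum Bochner_Integration.integral_sum)
    qed
    ultimately show ?thesis by simp
  qed
  have part: "(\<Sum>i=1..k. (lam (k+1) - lam i) powr p)
      \<le> max 4 (2 * p) * (\<Sum>i=1..k. (lam (k+1) - lam i) powr (p - 1) * Q j i)" if j: "j < d" for j
  proof -
    define a where "a i l = (\<integral>x. ((b j \<bullet> x) * u i x) * u l x \<partial>M)" for i l
    define c where "c i l = (\<integral>x. G i j x * u l x \<partial>M)" for i l
    have comm: "(lam l - lam i) * a i l = - 2 * c i l" if "1 \<le> i" "1 \<le> l" for i l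
      unfolding a_def c_def using eigenfunction_commutator[OF j W G G weak weak] that by blast
    show ?thesis
    proof (rule commutator_sum_inequality[where a = a])
      show "lam i \<le> lam l" if "1 \<le> i" "i \<le> l" for i l using mono that .
      show "a i l = a l i" for i l by (simp add: a_def mult_ac)
      fix i :: nat assume i: "1 \<le> i"
      \<comment> \<open>Parseval's identity for \<open>g u i\<close> and \<open>X j u i\<close>,
        whose inner product is -1/2 by \<open>coord_gradient_inner\<close>. The commutator relation
        rewrites each \<open>-2 * (a i l * c i l)\<close> as a weighted square.\<close>
      have "(\<lambda>N. \<Sum>l=1..N. a i l * c i l) \<longlonglongrightarrow> (\<integral>x. (b j \<bullet> x) * u i x * G i j x \<partial>M)"
        unfolding a_def c_def by (intro parseval L2_coord_mult L2 i j)
      then have "(\<lambda>N. - 2 * (\<Sum>l=1..N. a i l * c i l)) \<longlonglongrightarrow> - 2 * (- 1 / 2)"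
        using coord_gradient_inner[OF sob[OF i] j] norm1[OF i] by (intro tendsto_intros) simp
      moreover have "- 2 * (\<Sum>l=1..N. a i l * c i l) = (\<Sum>l=1..N. (lam l - lam i) * (a i l)\<^sup>2)" for N
        unfolding sum_distrib_left
      proof (rule sum.cong)
        fix l assume "l \<in> {1..N}"
        then have "a i l * ((lam l - lam i) * a i l) = a i l * (- 2 * c i l)" using comm[OF i] by simp
        then show "- 2 * (a i l * c i l) = (lam l - lam i) * (a i l)\<^sup>2"
          by (simp add: power2_eq_square mult_ac)
      qed simp
      ultimately show "(\<lambda>N. \<Sum>l=1..N. (lam l - lam i) * (a i l)\<^sup>2) \<longlonglongrightarrow> 1" by simp
      fix N
      have "(\<Sum>l=1..N. (lam l - lam i)\<^sup>2 * (a i l)\<^sup>2) = (\<Sum>l=1..N. 4 * (c i l)\<^sup>2)"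
      proof (rule sum.cong)
        fix l assume "l \<in> {1..N}"
        then have "((lam l - lam i) * a i l)\<^sup>2 = (- 2 * c i l)\<^sup>2" using comm[OF i] by simp
        then show "(lam l - lam i)\<^sup>2 * (a i l)\<^sup>2 = 4 * (c i l)\<^sup>2" by (simp add: power_mult_distrib)
      qed simp
      also have "\<dots> \<le> 4 * Q j i"
        unfolding Q_def c_def sum_distrib_left[symmetric] using bessel[OF L2(2)[OF i j]] by simp
      finally show "(\<Sum>l=1..N. (lam l - lam i)\<^sup>2 * (a i l)\<^sup>2) \<le> 4 * Q j i" .
    qed
  qed
  have "real d * (\<Sum>i=1..k. (lam (k+1) - lam i) powr p) = (\<Sum>j<d. \<Sum>i=1..k. (lam (k+1) - lam i) powr p)"
    by simp
  also have "\<dots> \<le> (\<Sum>j<d. max 4 (2 * p) * (\<Sum>i=1..k. (lam (k+1) - lam i) powr (p - 1) * Q j i))"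
    by (intro sum_mono part) simp
  also have "\<dots> = max 4 (2 * p) * (\<Sum>i=1..k. (lam (k+1) - lam i) powr (p - 1) * (\<Sum>j<d. Q j i))"
    unfolding sum_distrib_left[symmetric] by (subst sum.swap) (simp only: sum_distrib_left)
  also have "(\<Sum>i=1..k. (lam (k+1) - lam i) powr (p - 1) * (\<Sum>j<d. Q j i))
      = (\<Sum>i=1..k. (lam (k+1) - lam i) powr (p - 1) * (lam i - (\<integral>x. W x * (u i x)\<^sup>2 \<partial>M)))"
    by (intro sum.cong refl) (simp add: energy)
  finally show "(\<Sum>i=1..k. (lam (k+1) - lam i) powr p)
    \<le> max 4 (2 * p) / real d * (\<Sum>i=1..k. (lam (k+1) - lam i) powr (p - 1) *
         (lam i - (\<integral>x. W x * (u i x)\<^sup>2 \<partial>M)))"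
    using d by (simp only: times_divide_eq_left pos_le_divide_eq of_nat_0_less_iff mult.commute)
  have "0 \<le> (\<Sum>j<d. Q j i)" by (simp add: Q_def sum_nonneg)
  then show "(\<integral>x. W x * (u i x)\<^sup>2 \<partial>M) \<le> lam i" if "1 \<le> i" using energy[OF that] by simp
qed

lemma potential_energy_ge_inf:
  assumes spec: "discrete_dirichlet_spectrum gm Om b d W lam u" and bdd: "bdd_below (W ` Om)" and i: "1 \<le> i"
  shows "Inf (W ` Om) \<le> (\<integral>x. W x * (u i x)\<^sup>2 \<partial>M)"
proof -
  from spec i obtain G where "form_dom gm Om b d W (u i) G"
    unfolding discrete_dirichlet_spectrum_def dir_eigen_def by blast
  then have int: "integrable M (\<lambda>x. W x * (u i x)\<^sup>2)" "integrable M (\<lambda>x. (u i x)\<^sup>2)"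
    by (simp_all add: form_dom_def hsob0_def L2_def)
  have "(\<integral>x. (u i x)\<^sup>2 \<partial>M) = 1"
    using spec i unfolding discrete_dirichlet_spectrum_def by (simp add: power2_eq_square)
  then have "Inf (W ` Om) = (\<integral>x. Inf (W ` Om) * (u i x)\<^sup>2 \<partial>M)" by simp
  also have "\<dots> \<le> (\<integral>x. W x * (u i x)\<^sup>2 \<partial>M)"
    using int bdd by (intro integral_mono mult_right_mono) (auto simp: space_M intro: cInf_lower)
  finally show ?thesis .
qed

end

section \<open>Explicit upper bounds for the next eigenvalue\<close>

theorem theorem7p1:
  fixes gm :: "real^'n \<Rightarrow> real^'n \<Rightarrow> real^'n"
    and V :: "nat \<Rightarrow> (real^'n) set" and r :: nat
    and d :: nat and b :: "nat \<Rightarrow> real^'n"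
    and Om :: "(real^'n) set" and W :: "real^'n \<Rightarrow> real"
    and lam :: "nat \<Rightarrow> real" and u :: "nat \<Rightarrow> real^'n \<Rightarrow> real"
  assumes "carnot_group gm V r"
    and "d = dim (V 1)"
    and "\<forall>j<d. b j \<in> V 1"
    and "\<forall>i<d. \<forall>j<d. b i \<bullet> b j = (if i = j then 1 else 0)"
    and "open Om" and "connected Om" and "bounded Om" and "Om \<noteq> {}"
    and "discrete_dirichlet_spectrum gm Om b d W lam u"
  shows "(\<forall>k\<ge>1. \<forall>p::real.
            (\<Sum>i=1..k. (lam (k+1) - lam i) powr p)
              \<le> max 4 (2*p) / real d *
                (\<Sum>i=1..k. (lam (k+1) - lam i) powr (p - 1) *
                   (lam i - (\<integral>x. W x * (u i x)\<^sup>2 \<partial>dom_meas gm Om))))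
       \<and> (bdd_below (W ` Om) \<longrightarrow>
           (\<forall>k\<ge>1.
              lam (k+1) \<le> (1 + 4 / real d) * (1 / real k) * (\<Sum>i=1..k. lam i)
                           - 4 / real d * Inf (W ` Om)
            \<and> lam (k+1) \<le> (1 + 4 / real d) * real k powr (2 / real d) * lam 1
                           - ((1 + 4 / real d) * real k powr (2 / real d) - 1) * Inf (W ` Om)))"
proof -
  interpret carnot_domain gm V r Om d b
    by unfold_locales (use assms in auto)
  have d: "0 < d" using dim_V1_pos assms(2) by simp
  note yang = yang_type_inequality(1)[OF d assms(9)]
  have Suc: "\<And>i. 1 \<le> i \<Longrightarrow> lam i \<le> lam (Suc i)"
    using assms(9) unfolding discrete_dirichlet_spectrum_def by blast
  have mono: "lam i \<le> lam l" if "1 \<le> i" "i \<le> l" for i l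
    using that(2) by (induction rule: dec_induct) (use that(1) Suc in \<open>auto intro: order_trans\<close>)
  {
    assume bdd: "bdd_below (W ` Om)"
    define w where "w = Inf (W ` Om)"
    \<comment> \<open>The shift keeps all gaps and removes the potential from the inequality: the
      mean of \<open>W\<close> against \<open>u i\<close> lies between \<open>w\<close> and
      \<open>lam i\<close>, so the energy is at most \<open>\<mu> i\<close> and
      \<open>\<mu> i\<close> is nonnegative.\<close>
    define \<mu> where "\<mu> i = lam i - w" for i
    have T: "lam i - (\<integral>x. W x * (u i x)\<^sup>2 \<partial>M) \<le> \<mu> i" "0 \<le> lam i - (\<integral>x. W x * (u i x)\<^sup>2 \<partial>M)" if "1 \<le> i" for i
      using potential_energy_ge_inf[OF assms(9) bdd that] yang_type_inequality(2)[OF d assms(9) that]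
      by (simp_all add: \<mu>_def w_def)
    have yang_\<mu>: "(\<Sum>i=1..k. (\<mu> (k+1) - \<mu> i) powr p)
        \<le> max 4 (2 * p) / real d * (\<Sum>i=1..k. (\<mu> (k+1) - \<mu> i) powr (p - 1) * \<mu> i)" for k p
    proof -
      have "(\<Sum>i=1..k. (lam (k+1) - lam i) powr (p - 1) * (lam i - (\<integral>x. W x * (u i x)\<^sup>2 \<partial>M)))
          \<le> (\<Sum>i=1..k. (lam (k+1) - lam i) powr (p - 1) * \<mu> i)"
        using T by (intro sum_mono mult_left_mono) auto
      from order_trans[OF yang mult_left_mono[OF this, of "max 4 (2 * p) / real d"]] show ?thesis
        by (simp add: \<mu>_def)
    qed
    have \<mu>_nonneg: "0 \<le> \<mu> i" if "1 \<le> i" for i using T[OF that] by simp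
    have \<mu>_mono: "0 \<le> \<mu> (k+1) - \<mu> i" if "i \<in> {1..k}" for i k
      using mono[of i "k+1"] that by (simp add: \<mu>_def)
    have "lam (k+1) \<le> (1 + 4 / real d) * (1 / real k) * (\<Sum>i=1..k. lam i) - 4 / real d * w
      \<and> lam (k+1) \<le> (1 + 4 / real d) * real k powr (2 / real d) * lam 1
          - ((1 + 4 / real d) * real k powr (2 / real d) - 1) * w" if k: "1 \<le> k" for k
    proof
      have "real k * \<mu> (k+1) - (\<Sum>i=1..k. \<mu> i) = (\<Sum>i=1..k. \<mu> (k+1) - \<mu> i)"
        by (simp add: sum_subtractf)
      also have "\<dots> = (\<Sum>i=1..k. (\<mu> (k+1) - \<mu> i) powr 1)"
        using \<mu>_mono by (intro sum.cong) auto
      also have "\<dots> \<le> 4 / real d * (\<Sum>i=1..k. (\<mu> (k+1) - \<mu> i) powr 0 * \<mu> i)"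
        using yang_\<mu>[where p = 1 and k = k] by simp
      \<comment> \<open>An inequality only, as \<open>x powr 0\<close> is 1 for \<open>x > 0\<close>
        but 0 at a vanishing gap.\<close>
      also have "\<dots> \<le> 4 / real d * (\<Sum>i=1..k. \<mu> i)"
        using \<mu>_nonneg by (intro mult_left_mono sum_mono) (auto simp: powr_def)
      finally have "real k * \<mu> (k+1) \<le> (1 + 4 / real d) * (\<Sum>i=1..k. \<mu> i)" by (simp add: algebra_simps)
      moreover have "(\<Sum>i=1..k. \<mu> i) = (\<Sum>i=1..k. lam i) - real k * w" by (simp add: \<mu>_def sum_subtractf)
      ultimately have "\<mu> (k+1) \<le> (1 + 4 / real d) * ((\<Sum>i=1..k. lam i) - real k * w) / real k"
        using k by (simp only: pos_le_divide_eq of_nat_0_less_iff mult.commute[of "real k" "\<mu> (k+1)"])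
      also have "\<dots> = (1 + 4 / real d) * (1 / real k) * (\<Sum>i=1..k. lam i) - (1 + 4 / real d) * w"
        using k by (simp add: right_diff_distrib diff_divide_distrib)
      finally show "lam (k+1) \<le> (1 + 4 / real d) * (1 / real k) * (\<Sum>i=1..k. lam i) - 4 / real d * w"
        by (simp add: \<mu>_def distrib_right)
      \<comment> \<open>The case \<open>p = 2\<close> has constant \<open>4 / d\<close>, to be
        matched with \<open>2 * s\<close> in the recursion; hence \<open>s = 2 / d\<close>.\<close>
      have "\<mu> (k+1) \<le> (1 + 2 * (2 / real d)) * real k powr (2 / real d) * \<mu> 1"
      proof (rule cheng_yang_recursion)
        fix k :: nat assume "1 \<le> k"
        have "(\<Sum>i=1..k. (\<mu> (k+1) - \<mu> i)\<^sup>2) = (\<Sum>i=1..k. (\<mu> (k+1) - \<mu> i) powr 2)"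
          using \<mu>_mono by (intro sum.cong) (auto simp: powr_numeral)
        also have "\<dots> \<le> 4 / real d * (\<Sum>i=1..k. (\<mu> (k+1) - \<mu> i) powr 1 * \<mu> i)"
          using yang_\<mu>[where p = 2 and k = k] by simp
        also have "(\<Sum>i=1..k. (\<mu> (k+1) - \<mu> i) powr 1 * \<mu> i) = (\<Sum>i=1..k. (\<mu> (k+1) - \<mu> i) * \<mu> i)"
          using \<mu>_mono by (intro sum.cong) auto
        finally show "(\<Sum>i=1..k. (\<mu> (k+1) - \<mu> i)\<^sup>2) \<le> 2 * (2 / real d) * (\<Sum>i=1..k. (\<mu> (k+1) - \<mu> i) * \<mu> i)"
          by simp
      qed (use d k \<mu>_nonneg in auto)
      moreover define K where "K = (1 + 4 / real d) * real k powr (2 / real d)"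
      ultimately have "lam (k+1) - w \<le> K * (lam 1 - w)" by (simp add: \<mu>_def)
      then show "lam (k+1) \<le> (1 + 4 / real d) * real k powr (2 / real d) * lam 1
          - ((1 + 4 / real d) * real k powr (2 / real d) - 1) * w"
        unfolding K_def[symmetric] by (simp add: algebra_simps)
    qed
  }
  note bounds = this
  show ?thesis
    by (intro conjI allI impI yang bounds[THEN conjunct1] bounds[THEN conjunct2]) assumption+
qed

end
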